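(* Let $\triangle ABC$ be in the ($N=3$) Steiner-Soddy family and let $\triangle A'B'C'$ be its pedal triangle with respect to $I$. Over the porism, the left and right hand side of each of the following equations are conserved (constant over the family) and identical: $$\tan\frac{A}{2}+\tan\frac{B}{2}+\tan\frac{C}{2}=\cot A'+\cot B'+\cot C',$$ $$\tan^2\frac{A}{2}+\tan^2\frac{B}{2}+\tan^2\frac{C}{2}=\cot^2 A'+\cot^2 B'+\cot^2 C'.$$
   Context: Consider three congruent circles centered at the vertices of an equilateral triangle, pairwise tangent. By symmetry, all of them are tangent to an inner circle and to an outer circle. The image of this configuration under inversion in a fixed circle is a Steiner chain: three pairwise tangent circles, all tangent to two fixed circles (the inner and outer Soddy circles, images of the two concentric circles). Rotating the equilateral triangle about its center, with the inversion circle fixed, gives a one-parameter family of such chains with the same Soddy circles, called the Steiner porism. The Steiner-Soddy triangle $ABC$ has as vertices the centers of the three circles of the chain; the Steiner-Soddy family is the family of these triangles over the porism. All triangles of the family are inscribed in one fixed conic (an ellipse, a hyperbola, or a parabola). The points of contact of the circles of the chain lie on one fixed circle (the inversive image of the incircle of the equilateral triangle), whose center is denoted $I$; the sides of $ABC$ are tangent to this circle. The vertices $A',B',C'$ of the pedal triangle of $ABC$ with respect to $I$ are these points of contact, lying on the sides $BC$, $CA$, $AB$ respectively. In the equations, $A,B,C$ denote the internal angles of $\triangle ABC$ and $A',B',C'$ the internal angles of $\triangle A'B'C'$. Sign convention: when the conic is a hyperbola, the sign of the half-angle tangent must be flipped for the two angles of $ABC$ whose neighboring vertices lie on different branches of the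 hyperbola.
   Formalization: The sign convention fails for triangles with vertices on both branches of the hyperbola; there, with A alone on its branch, the half-angle tangents are replaced by −tan(A/2), cot(B/2), cot(C/2) instead of flipping the signs of tan(B/2), tan(C/2). *)

theory Defs
  imports "HOL-Analysis.Analysis"
begin

(* Inversion in the circle of centre P and radius k.  The centre P has no image; since division
   by zero is zero, the formula below leaves P fixed.  The image of a circle is again a sphere
   (as a set) exactly when the circle does not pass through P. *)
definition inversion :: "complex \<Rightarrow> real \<Rightarrow> complex \<Rightarrow> complex" where
  "inversion P k z = P + (k\<^sup>2 / (dist z P)\<^sup>2) *\<^sub>R (z - P)"

(* Three congruent circles of radius r, centred at the vertices of an equilateral triangle with
   centre Q, are pairwise tangent iff the side is 2 r, i.e. the circumradius is 2 r / sqrt 3 and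
   the inradius is r / sqrt 3. *)
definition equilateral_vertex :: "complex \<Rightarrow> real \<Rightarrow> real \<Rightarrow> complex" where
  "equilateral_vertex Q r \<theta> = Q + complex_of_real (2 * r / sqrt 3) * cis \<theta>"

definition chain_centre :: "complex \<Rightarrow> real \<Rightarrow> complex \<Rightarrow> real \<Rightarrow> real \<Rightarrow> complex \<Rightarrow> bool" where
  "chain_centre P k Q r \<theta> A \<longleftrightarrow>
     (\<exists>a>0. inversion P k ` sphere (equilateral_vertex Q r \<theta>) r = sphere A a)"

(* The angle \<theta> is the parameter of the porism.  Positions in which one of the three circles
   passes through P give a line instead of a circle, and no triangle. *)
definition steiner_soddy_family ::
    "complex \<Rightarrow> real \<Rightarrow> complex \<Rightarrow> real \<Rightarrow> (complex \<times> complex \<times> complex) set" where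
  "steiner_soddy_family P k Q r =
     {(A, B, C). \<exists>\<theta>. chain_centre P k Q r \<theta> A \<and> chain_centre P k Q r (\<theta> + 2 * pi / 3) B \<and>
                     chain_centre P k Q r (\<theta> + 4 * pi / 3) C}"

definition family_vertices :: "(complex \<times> complex \<times> complex) set \<Rightarrow> complex set" where
  "family_vertices \<F> = (\<Union>(A, B, C)\<in>\<F>. {A, B, C})"

definition foot_of_perpendicular :: "complex \<Rightarrow> complex \<Rightarrow> complex \<Rightarrow> complex \<Rightarrow> bool" where
  "foot_of_perpendicular I B C X \<longleftrightarrow> X \<in> affine hull {B, C} \<and> orthogonal (I - X) (C - B)"

definition pedal_triangle ::
    "complex \<Rightarrow> complex \<Rightarrow> complex \<Rightarrow> complex \<Rightarrow> complex \<Rightarrow> complex \<Rightarrow> complex \<Rightarrow> bool" where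
  "pedal_triangle I A B C A' B' C' \<longleftrightarrow>
     foot_of_perpendicular I B C A' \<and> foot_of_perpendicular I C A B' \<and>
     foot_of_perpendicular I A B C'"

(* internal angle at X of the triangle X Y Z *)
definition internal_angle :: "complex \<Rightarrow> complex \<Rightarrow> complex \<Rightarrow> real" where
  "internal_angle X Y Z = arccos (((Y - X) \<bullet> (Z - X)) / (norm (Y - X) * norm (Z - X)))"

(* the branch around the focus F of the hyperbola with foci F, G and real axis of length c *)
definition hyperbola_branch :: "complex \<Rightarrow> complex \<Rightarrow> real \<Rightarrow> complex set" where
  "hyperbola_branch F G c = {X. dist X G - dist X F = c}"

(* X and Y lie on different branches of a hyperbola circumscribing the whole family;
   false when the conic circumscribing the family is an ellipse or a parabola. *)
definition on_different_branches ::
    "(complex \<times> complex \<times> complex) set \<Rightarrow> complex \<Rightarrow> complex \<Rightarrow> bool" where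
  "on_different_branches \<F> X Y \<longleftrightarrow>
     (\<exists>F G c. 0 < c \<and> c < dist F G \<and>
        family_vertices \<F> \<subseteq> hyperbola_branch F G c \<union> hyperbola_branch G F c \<and>
        X \<in> hyperbola_branch F G c \<and> Y \<in> hyperbola_branch G F c)"

(* Half-angle tangent at the vertex X of the triangle X Y Z, with the sign convention for
   hyperbolas.  If a vertex, say A, is alone on its branch, then its circle surrounds the two
   others and has negative curvature in the chain.  The sides AB and AC, which join different
   branches, are differences of radii, and count as negative lengths.  By the law of cosines
   this flips the sign of the cosine at the two vertices whose neighbours are on different
   branches, i.e. replaces the angles B and C by their supplements, so that the half-angle
   tangent becomes the cotangent; and it flips the sign of tan (A/2).  Equivalently, the circle
   of contact points is then the excircle opposite A, and for an inradius or exradius \<rho> the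
   signed half-angle tangent is always \<rho> times the signed curvature of the chain circle.
   Changing only the signs of tan (B/2) and tan (C/2) would not give conserved sums: a mixed
   triangle may be equilateral, with the sum of squares 1, in a family where it is 19/3. *)
definition half_angle_tan ::
    "(complex \<times> complex \<times> complex) set \<Rightarrow> complex \<Rightarrow> complex \<Rightarrow> complex \<Rightarrow> real" where
  "half_angle_tan \<F> X Y Z =
     (if on_different_branches \<F> Y Z then tan ((pi - internal_angle X Y Z) / 2)
      else if on_different_branches \<F> X Y \<and> on_different_branches \<F> X Z
           then - tan (internal_angle X Y Z / 2)
      else tan (internal_angle X Y Z / 2))"

end

theory Submission
  imports Defs
begin

text \<open>
  The half-angle tangents and the cotangents are, up to one common factor, powers of a point. Let
  \<open>w\<close> be the power of the inversion centre \<open>P\<close> with respect to a circle of centre \<open>c\<close> and radius \<open>r\<close>.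
  The image circle has centre
  \<open>P + (k\<^sup>2 / w) (c - P)\<close> and signed radius \<open>k\<^sup>2 r / w\<close>; a negative sign means that \<open>P\<close> is inside the
  original circle, so that the image surrounds the other two circles of its chain. With signed radii,
  tangency keeps the form ``squared distance = (sum of radii) squared'' under inversion, and
  orthogonality keeps the form ``squared distance = sum of squared radii'' (\<open>dist_inverse_centres\<close>).

  Let \<open>\<iota>\<close> be the radius of the circle of contact points and \<open>x, y, z\<close> the quotients of \<open>\<iota>\<close> by the
  three signed radii. They are proportional to the powers \<open>w\<close> of the three circles, which for the
  rotating equilateral triangle have the form \<open>m + n cos (\<theta> - \<phi>)\<close> at three angles that are 120 degrees
  apart. So \<open>x + y + z\<close> and \<open>x y + y z + z x\<close> are constant, and the second is 1
  (\<open>chain_power_sums\<close>). The sum of squares is then constant, too.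

  These three numbers are the quantities of the theorem. Given \<open>x y + y z + z x = 1\<close>, the law of
  cosines gives \<open>cos A = \<plusminus> (1 - x\<^sup>2) / (1 + x\<^sup>2)\<close> with the sign of \<open>y z\<close>, whence
  \<open>tan (A / 2) = \<bar>x\<bar>\<close> for the angle \<open>A\<close> or for its supplement. The contact points divide the
  sides in the ratio of the signed radii, and their mutual distances are \<open>2 \<iota> / sqrt (1 + x\<^sup>2)\<close> and so on,
  whence \<open>cot A' = x\<close> (\<open>cot_pedal_angle_A\<close>).

  It remains to match the sign convention: two vertices lie on different branches of the
  circumscribed hyperbola exactly when their powers have different signs
  (\<open>on_different_branches_iff\<close>). If both signs occur, the centres of the two Soddy circles are foci,
  and the difference of the distances to them changes its sign with \<open>w\<close>. Conversely,
  vertices with positive powers form an arc, and a continuous curve on any hyperbola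
  stays on one branch.
\<close>

section \<open>Inversion and signed radii\<close>

definition point_power :: "complex \<Rightarrow> complex \<Rightarrow> real \<Rightarrow> real" where
  "point_power P c r = (dist c P)\<^sup>2 - r\<^sup>2"

definition inverse_centre :: "complex \<Rightarrow> real \<Rightarrow> complex \<Rightarrow> real \<Rightarrow> complex" where
  "inverse_centre P k c r = P + (k\<^sup>2 / point_power P c r) *\<^sub>R (c - P)"

text \<open>
  A negative value means that \<open>P\<close> is inside the circle, whose interior is then mapped to the
  exterior of the image circle.
\<close>
definition inverse_radius :: "complex \<Rightarrow> real \<Rightarrow> complex \<Rightarrow> real \<Rightarrow> real" where
  "inverse_radius P k c r = k\<^sup>2 * r / point_power P c r"

lemma inversion_eq_inverse_centre: "inversion P k z = inverse_centre P k z 0"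
  by (simp add: inversion_def inverse_centre_def point_power_def)

lemma power2_norm_diff_scaleR:
  fixes u v :: "'a::real_inner"
  shows "(norm (\<alpha> *\<^sub>R u - \<beta> *\<^sub>R v))\<^sup>2 = \<alpha>\<^sup>2 * (u \<bullet> u) + \<beta>\<^sup>2 * (v \<bullet> v) - 2 * ((\<alpha> * \<beta>) * (v \<bullet> u))"
  unfolding power2_norm_eq_inner
  by (simp add: inner_diff inner_commute power2_eq_square algebra_simps)

text \<open>
  The quotient of \<open>(dist c d)\<^sup>2 - r\<^sup>2 - s\<^sup>2\<close> by \<open>r s\<close> is the inversive invariant of two circles: it is \<open>2\<close>
  for external and \<open>- 2\<close> for internal tangency, and \<open>0\<close> for orthogonality. With signed
  radii the formula needs no case distinction on the position of \<open>P\<close>, and with \<open>s = 0\<close> it describes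
  the image of a single point.
\<close>
lemma dist_inverse_centres:
  assumes "point_power P c r \<noteq> 0" "point_power P d s \<noteq> 0"
  shows "(dist (inverse_centre P k c r) (inverse_centre P k d s))\<^sup>2 =
    (inverse_radius P k c r)\<^sup>2 + (inverse_radius P k d s)\<^sup>2
      + k ^ 4 * ((dist c d)\<^sup>2 - r\<^sup>2 - s\<^sup>2) / (point_power P c r * point_power P d s)"
proof -
  define u v where "u = c - P" and "v = d - P"
  define p q where "p = point_power P c r" and "q = point_power P d s"
  have p: "u \<bullet> u = p + r\<^sup>2" and q: "v \<bullet> v = q + s\<^sup>2"
    by (simp_all add: p_def q_def u_def v_def point_power_def dist_norm power2_norm_eq_inner)
  have "c - d = u - v"
    by (simp add: u_def v_def)
  then have cd: "(dist c d)\<^sup>2 = u \<bullet> u + v \<bullet> v - 2 * (u \<bullet> v)"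
    by (simp add: dist_norm power2_norm_eq_inner inner_diff inner_commute)
  have "(dist (inverse_centre P k c r) (inverse_centre P k d s))\<^sup>2
      = (norm ((k\<^sup>2 / p) *\<^sub>R u - (k\<^sup>2 / q) *\<^sub>R v))\<^sup>2"
    by (simp add: inverse_centre_def dist_norm p_def q_def u_def v_def)
  also have "\<dots> = (k\<^sup>2 / p)\<^sup>2 * (u \<bullet> u) + (k\<^sup>2 / q)\<^sup>2 * (v \<bullet> v)
      - 2 * (k\<^sup>2 / p) * (k\<^sup>2 / q) * (u \<bullet> v)"
    by (simp add: power2_norm_diff_scaleR inner_commute)
  also have "\<dots> = (k\<^sup>2 * r / p)\<^sup>2 + (k\<^sup>2 * s / q)\<^sup>2
      + k ^ 4 * ((dist c d)\<^sup>2 - r\<^sup>2 - s\<^sup>2) / (p * q)"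
    using assms unfolding cd p q p_def[symmetric] q_def[symmetric]
    by (simp add: field_simps power2_eq_square power4_eq_xxxx)
  finally show ?thesis
    by (simp add: inverse_radius_def p_def q_def)
qed

text \<open>
  Internal tangency is covered by giving one of the two circles a negative radius.
\<close>
lemma dist_inverse_centres_tangent:
  assumes "point_power P c r \<noteq> 0" "point_power P d s \<noteq> 0" "(dist c d)\<^sup>2 = (r + s)\<^sup>2"
  shows "(dist (inverse_centre P k c r) (inverse_centre P k d s))\<^sup>2 =
    (inverse_radius P k c r + inverse_radius P k d s)\<^sup>2"
proof -
  have "(dist c d)\<^sup>2 - r\<^sup>2 - s\<^sup>2 = 2 * r * s"
    unfolding assms(3) by (simp add: power2_sum)
  then show ?thesis
    unfolding dist_inverse_centres[OF assms(1,2)] power2_sum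
    by (simp add: inverse_radius_def power2_eq_square power4_eq_xxxx)
qed

lemma inverse_minus_radius:
  "point_power P c (- r) = point_power P c r"
  "inverse_centre P k c (- r) = inverse_centre P k c r"
  "inverse_radius P k c (- r) = - inverse_radius P k c r"
  by (simp_all add: point_power_def inverse_centre_def inverse_radius_def)

lemma point_power_inverse:
  assumes "point_power P c r \<noteq> 0"
  shows "point_power P (inverse_centre P k c r) (inverse_radius P k c r)
    = k ^ 4 / point_power P c r"
proof -
  have "(dist (inverse_centre P k c r) P)\<^sup>2 = (k\<^sup>2 / point_power P c r)\<^sup>2 * (dist c P)\<^sup>2"
    by (simp add: inverse_centre_def dist_norm power_mult_distrib power_divide)
  moreover have "(dist c P)\<^sup>2 = point_power P c r + r\<^sup>2"
    by (simp add: point_power_def)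
  ultimately have "point_power P (inverse_centre P k c r) (inverse_radius P k c r)
    = (k\<^sup>2 / point_power P c r)\<^sup>2 * (point_power P c r + r\<^sup>2) - (inverse_radius P k c r)\<^sup>2"
    by (metis point_power_def)
  with assms show ?thesis
    by (simp add: inverse_radius_def field_simps power2_eq_square power4_eq_xxxx)
qed

lemma inverse_centre_involution:
  assumes "k \<noteq> 0" "point_power P c r \<noteq> 0"
  shows "inverse_centre P k (inverse_centre P k c r) (inverse_radius P k c r) = c"
proof -
  have "inverse_centre P k (inverse_centre P k c r) (inverse_radius P k c r)
    = P + (k\<^sup>2 / (k ^ 4 / point_power P c r)) *\<^sub>R ((k\<^sup>2 / point_power P c r) *\<^sub>R (c - P))"
    unfolding inverse_centre_def[of P k "inverse_centre P k c r"] point_power_inverse[OF assms(2)]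
    by (simp add: inverse_centre_def)
  then show ?thesis
    using assms by (simp add: power2_eq_square power4_eq_xxxx)
qed

lemma inverse_radius_involution:
  assumes "k \<noteq> 0" "point_power P c r \<noteq> 0"
  shows "inverse_radius P k (inverse_centre P k c r) (inverse_radius P k c r) = r"
  using assms unfolding inverse_radius_def[of P k "inverse_centre P k c r"] point_power_inverse[OF assms(2)]
  by (simp add: inverse_radius_def power2_eq_square power4_eq_xxxx)

lemma dist_eq_abs:
  assumes "(dist X Y)\<^sup>2 = t\<^sup>2"
  shows "dist X Y = \<bar>t\<bar>"
  using arg_cong[OF assms, of sqrt] by simp

lemma inversion_in_inverse_sphere:
  assumes "point_power P c r \<noteq> 0" "z \<in> sphere c r"
  shows "inversion P k z \<in> sphere (inverse_centre P k c r) \<bar>inverse_radius P k c r\<bar>"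
proof -
  have r: "r = dist z c"
    using assms(2) by (simp add: dist_commute)
  then have "z \<noteq> P"
    using assms(1) by (auto simp: point_power_def dist_commute)
  then have "point_power P z 0 \<noteq> 0"
    by (simp add: point_power_def)
  from dist_inverse_centres[OF assms(1) this, of k]
  have "(dist (inverse_centre P k c r) (inversion P k z))\<^sup>2 = (inverse_radius P k c r)\<^sup>2"
    by (simp add: inversion_eq_inverse_centre r dist_commute inverse_radius_def)
  from dist_eq_abs[OF this] show ?thesis
    by simp
qed

lemma inversion_involution: "k \<noteq> 0 \<Longrightarrow> inversion P k (inversion P k z) = z"
proof (cases "z = P")
  case False
  assume "k \<noteq> 0"
  from False have "point_power P z 0 \<noteq> 0"
    by (simp add: point_power_def)
  from inverse_centre_involution[OF \<open>k \<noteq> 0\<close> this] show ?thesis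
    by (simp add: inversion_eq_inverse_centre inverse_radius_def)
qed (simp add: inversion_def)

lemma inversion_image_sphere:
  assumes "k \<noteq> 0" "r > 0" "point_power P c r \<noteq> 0"
  shows "inversion P k ` sphere c r = sphere (inverse_centre P k c r) \<bar>inverse_radius P k c r\<bar>"
proof
  show "inversion P k ` sphere c r \<subseteq> sphere (inverse_centre P k c r) \<bar>inverse_radius P k c r\<bar>"
    using inversion_in_inverse_sphere[OF assms(3)] by blast
next
  define C \<rho> where "C = inverse_centre P k c r" and "\<rho> = inverse_radius P k c r"
  have pow_abs: "point_power P C \<bar>\<rho>\<bar> = point_power P C \<rho>"
    by (simp add: point_power_def)
  have "point_power P C \<bar>\<rho>\<bar> \<noteq> 0"
    using point_power_inverse[OF assms(3), of k] assms unfolding pow_abs by (simp add: C_def \<rho>_def)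
  moreover have "inverse_centre P k C \<bar>\<rho>\<bar> = c"
    using inverse_centre_involution[OF assms(1,3)]
    by (simp only: inverse_centre_def[of P k C] pow_abs C_def[symmetric] \<rho>_def[symmetric])
  moreover have "\<bar>inverse_radius P k C \<bar>\<rho>\<bar>\<bar> = r"
  proof -
    have "\<bar>inverse_radius P k C \<bar>\<rho>\<bar>\<bar> = \<bar>inverse_radius P k C \<rho>\<bar>"
      by (simp add: inverse_radius_def pow_abs abs_mult)
    then show ?thesis
      using inverse_radius_involution[OF assms(1,3)] \<open>r > 0\<close> by (simp flip: C_def \<rho>_def)
  qed
  ultimately have "inversion P k y \<in> sphere c r" if "y \<in> sphere C \<bar>\<rho>\<bar>" for y
    using inversion_in_inverse_sphere[of P C "\<bar>\<rho>\<bar>" y k] that by simp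
  then have "y \<in> inversion P k ` sphere c r" if "y \<in> sphere C \<bar>\<rho>\<bar>" for y
    using that by (intro image_eqI[where x = "inversion P k y"])
      (simp_all only: inversion_involution[OF assms(1)])
  then show "sphere C \<bar>\<rho>\<bar> \<subseteq> inversion P k ` sphere c r"
    by blast
qed

text \<open>
  Points of the circle arbitrarily close to \<open>P\<close>, other than \<open>P\<close> itself, have images arbitrarily far away.
\<close>
lemma inversion_image_sphere_through_centre:
  assumes "k \<noteq> 0" "r > 0" "point_power P c r = 0"
  shows "\<not> bounded (inversion P k ` sphere c r)"
proof
  assume "bounded (inversion P k ` sphere c r)"
  then obtain b where b: "\<forall>y\<in>inversion P k ` sphere c r. dist P y \<le> b"
    using bounded_any_center[of _ P] by blast
  define M where "M = max 1 b"
  have M: "M > 0" "\<And>z. z \<in> sphere c r \<Longrightarrow> dist P (inversion P k z) \<le> M"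
    using b by (force simp: M_def)+
  have "P \<in> sphere c r"
    using assms(2,3) by (simp add: point_power_def)
  moreover have "\<nexists>x. sphere c r = {x}"
  proof
    assume "\<exists>x. sphere c r = {x}"
    then obtain x where "sphere c r = {x}" ..
    moreover have "c + of_real r \<in> sphere c r" "c - of_real r \<in> sphere c r"
      using assms(2) by (simp_all add: dist_norm)
    ultimately have "c + of_real r = c - of_real r"
      by (metis singletonD)
    then show False using assms(2) by (simp add: complex_eq_iff)
  qed
  ultimately have "P islimpt sphere c r"
    by (intro connected_imp_perfect connected_sphere) auto
  moreover have "k\<^sup>2 / M > 0"
    using M(1) assms(1) by simp
  ultimately obtain z where z: "z \<in> sphere c r" "z \<noteq> P" "dist z P < k\<^sup>2 / M"
    unfolding islimpt_approachable by blast
  have "dist P (inversion P k z) = (k\<^sup>2 / (dist z P)\<^sup>2) * norm (z - P)"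
    by (simp only: inversion_def dist_norm norm_minus_commute[of P] add_diff_cancel_left' norm_scaleR)
       simp
  also have "\<dots> = k\<^sup>2 / dist z P"
    by (simp add: dist_norm power2_eq_square)
  finally have "dist P (inversion P k z) = k\<^sup>2 / dist z P" .
  with M(2)[OF z(1)] z(2,3) M(1) show False
    by (simp add: field_simps)
qed

text \<open>
  If \<open>A \<noteq> B\<close>, the two ends of the diameter on the line \<open>A B\<close> have the different distances
  \<open>\<bar>a - dist A B\<bar>\<close> and \<open>a + dist A B\<close> from \<open>B\<close>.
\<close>
lemma sphere_centre_unique:
  fixes A B :: complex
  assumes "sphere A a = sphere B b" "a > 0"
  shows "A = B"
proof (rule ccontr)
  assume "A \<noteq> B"
  define e where "e = sgn (B - A)"
  have e: "norm e = 1"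
    using \<open>A \<noteq> B\<close> by (simp add: e_def norm_sgn)
  have "dist A B *\<^sub>R e = B - A"
    using \<open>A \<noteq> B\<close> by (simp only: e_def sgn_div_norm dist_norm norm_minus_commute[of A]) simp
  then have BA: "B = A + dist A B *\<^sub>R e"
    by simp
  have ge: "dist A (A + t *\<^sub>R e) = \<bar>t\<bar>" "dist B (A + t *\<^sub>R e) = \<bar>t - dist A B\<bar>" for t
  proof -
    show "dist A (A + t *\<^sub>R e) = \<bar>t\<bar>"
      by (simp add: dist_norm e)
    have "B - (A + t *\<^sub>R e) = (dist A B - t) *\<^sub>R e"
      by (subst BA) (simp add: algebra_simps)
    then show "dist B (A + t *\<^sub>R e) = \<bar>t - dist A B\<bar>"
      by (simp add: dist_norm[of B "A + t *\<^sub>R e"] e abs_minus_commute)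
  qed
  have "A + a *\<^sub>R e \<in> sphere A a" "A + (-a) *\<^sub>R e \<in> sphere A a"
    using assms(2) by (auto simp only: mem_sphere ge)
  then have "\<bar>a - dist A B\<bar> = b" "\<bar>-a - dist A B\<bar> = b"
    unfolding assms(1) mem_sphere ge by auto
  then show False
    using \<open>A \<noteq> B\<close> assms(2) by (auto simp: abs_if split: if_splits)
qed

lemma inversion_image_eq_sphere:
  assumes "k \<noteq> 0" "r > 0" "inversion P k ` sphere c r = sphere A a"
  shows "point_power P c r \<noteq> 0" "A = inverse_centre P k c r"
proof -
  show p: "point_power P c r \<noteq> 0"
    using inversion_image_sphere_through_centre[OF assms(1,2), of P c] bounded_sphere[of A a]
    unfolding assms(3) by blast
  have "\<bar>inverse_radius P k c r\<bar> > 0"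
    using assms p by (simp add: inverse_radius_def)
  then show "A = inverse_centre P k c r"
    using sphere_centre_unique[OF inversion_image_sphere[OF assms(1,2) p, unfolded assms(3), symmetric]]
    by simp
qed

lemma chain_centre_iff:
  assumes "k \<noteq> 0" "r > 0"
  shows "chain_centre P k Q r \<theta> A \<longleftrightarrow>
    point_power P (equilateral_vertex Q r \<theta>) r \<noteq> 0 \<and>
    A = inverse_centre P k (equilateral_vertex Q r \<theta>) r" (is "_ \<longleftrightarrow> ?p \<noteq> 0 \<and> _")
proof
  assume "chain_centre P k Q r \<theta> A"
  then obtain a where "inversion P k ` sphere (equilateral_vertex Q r \<theta>) r = sphere A a"
    by (auto simp: chain_centre_def)
  from inversion_image_eq_sphere[OF assms this]
  show "?p \<noteq> 0 \<and> A = inverse_centre P k (equilateral_vertex Q r \<theta>) r"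
    by simp
next
  assume p: "?p \<noteq> 0 \<and> A = inverse_centre P k (equilateral_vertex Q r \<theta>) r"
  then have "\<bar>inverse_radius P k (equilateral_vertex Q r \<theta>) r\<bar> > 0"
    using assms by (simp add: inverse_radius_def)
  moreover have "inversion P k ` sphere (equilateral_vertex Q r \<theta>) r
      = sphere A \<bar>inverse_radius P k (equilateral_vertex Q r \<theta>) r\<bar>"
    using inversion_image_sphere[OF assms, of P "equilateral_vertex Q r \<theta>"] p by simp
  ultimately show "chain_centre P k Q r \<theta> A"
    unfolding chain_centre_def by blast
qed

section \<open>The triangle of centres of three tangent circles\<close>

text \<open>
  The circle with centre \<open>I\<close> and radius \<open>\<iota>\<close> is orthogonal to three mutually tangent circles whose
  signed radii are \<open>\<iota> / x\<close>, \<open>\<iota> / y\<close>, \<open>\<iota> / z\<close>. It touches the sides of the triangle of centres, being its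
  incircle if \<open>x, y, z\<close> are all positive, and the excircle opposite the vertex of the surrounding
  circle if one of them is negative.
\<close>
locale tangent_circles =
  fixes A B C I :: complex and \<iota> x y z :: real
  assumes \<iota>: "\<iota> > 0"
    and nonzero: "x \<noteq> 0" "y \<noteq> 0" "z \<noteq> 0"
    and sum_pos: "x + y + z > 0"
    and sum_products: "x * y + y * z + z * x = 1"
    and AB: "(dist A B)\<^sup>2 = (\<iota> / x + \<iota> / y)\<^sup>2"
    and BC: "(dist B C)\<^sup>2 = (\<iota> / y + \<iota> / z)\<^sup>2"
    and CA: "(dist C A)\<^sup>2 = (\<iota> / z + \<iota> / x)\<^sup>2"
    and IA: "(dist I A)\<^sup>2 = \<iota>\<^sup>2 + (\<iota> / x)\<^sup>2"
    and IB: "(dist I B)\<^sup>2 = \<iota>\<^sup>2 + (\<iota> / y)\<^sup>2"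
    and IC: "(dist I C)\<^sup>2 = \<iota>\<^sup>2 + (\<iota> / z)\<^sup>2"
begin

lemma rotate: "tangent_circles B C A I \<iota> y z x"
  using \<iota> nonzero sum_pos sum_products AB BC CA IA IB IC
  by unfold_locales (auto simp: algebra_simps)

text \<open>
  As \<open>(x + y) (x + z) = 1 + x\<^sup>2\<close>, the three pair sums have the same sign, which is that of
  their total. In particular, at most one of the three radii is negative.
\<close>
lemma sum_pair_pos: "x + y > 0" "y + z > 0" "z + x > 0"
proof -
  have "(x + y) * (z + x) = 1 + x\<^sup>2" "(x + y) * (y + z) = 1 + y\<^sup>2" "(y + z) * (z + x) = 1 + z\<^sup>2"
    using sum_products by (simp_all add: algebra_simps power2_eq_square)
  then have "(x + y) * (z + x) > 0" "(x + y) * (y + z) > 0" "(y + z) * (z + x) > 0"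
    by (simp_all add: add_pos_nonneg)
  then show "x + y > 0" "y + z > 0" "z + x > 0"
    using sum_pos by (auto simp: zero_less_mult_iff)
qed

lemma inner_at_A: "(B - A) \<bullet> (C - A) = \<iota>\<^sup>2 * (1 - x\<^sup>2) / (x\<^sup>2 * (y * z))"
proof -
  have "B - C = (B - A) - (C - A)" by simp
  then have "(B - A) \<bullet> (C - A) = ((dist A B)\<^sup>2 + (dist C A)\<^sup>2 - (dist B C)\<^sup>2) / 2"
    by (simp only: dist_norm norm_minus_commute[of A B]) (simp add: dot_norm_neg)
  also have "\<dots> = \<iota>\<^sup>2 * (x * y + y * z + z * x - x\<^sup>2) / (x\<^sup>2 * (y * z))"
    unfolding AB BC CA using nonzero by (simp add: field_simps power2_eq_square)
  finally show ?thesis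
    by (simp add: sum_products)
qed

lemma cos_internal_angle_A:
  "((B - A) \<bullet> (C - A)) / (norm (B - A) * norm (C - A)) = sgn (y * z) * ((1 - x\<^sup>2) / (1 + x\<^sup>2))"
proof -
  have BA: "norm (B - A) = \<bar>\<iota> / x + \<iota> / y\<bar>" and CA': "norm (C - A) = \<bar>\<iota> / z + \<iota> / x\<bar>"
    using dist_eq_abs[OF AB] dist_eq_abs[OF CA] by (simp_all add: dist_norm norm_minus_commute)
  have "(\<iota> / x + \<iota> / y) * (\<iota> / z + \<iota> / x) = \<iota>\<^sup>2 * ((x + y) * (z + x)) / (x\<^sup>2 * (y * z))"
    using nonzero by (simp add: field_simps power2_eq_square)
  also have "(x + y) * (z + x) = 1 + x\<^sup>2"
    using sum_products by (simp add: algebra_simps power2_eq_square)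
  finally have prod: "norm (B - A) * norm (C - A) = \<iota>\<^sup>2 * (1 + x\<^sup>2) / (x\<^sup>2 * \<bar>y * z\<bar>)"
    unfolding BA CA' abs_mult[symmetric] by (simp add: abs_mult add_nonneg_nonneg)
  have s: "sgn (y * z) = \<bar>y * z\<bar> / (y * z)"
    by (simp add: sgn_if)
  have pos: "1 + x\<^sup>2 \<noteq> 0"
    by (metis add_pos_nonneg less_numeral_extra(1) less_numeral_extra(3) zero_le_power2)
  show ?thesis
    unfolding inner_at_A prod s using nonzero \<iota> pos by (simp add: divide_simps)
qed
end

lemma tan_half_arccos:
  assumes "t \<ge> 0"
  shows "tan (arccos ((1 - t\<^sup>2) / (1 + t\<^sup>2)) / 2) = t"
proof -
  have "cos (2 * arctan t) = (1 - t\<^sup>2) / (1 + t\<^sup>2)"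
    by (simp add: cos_double cos_arctan sin_arctan power_divide diff_divide_distrib)
  moreover have "arccos (cos (2 * arctan t)) = 2 * arctan t"
    using assms arctan_ubound[of t] by (intro arccos_cos) auto
  ultimately show ?thesis
    by (simp add: tan_arctan)
qed

lemma cot_arccos: "cot (arccos (t / sqrt (1 + t\<^sup>2))) = t"
proof -
  have "\<bar>t\<bar> < sqrt (1 + t\<^sup>2)"
    by (simp add: real_less_rsqrt)
  then have "\<bar>t / sqrt (1 + t\<^sup>2)\<bar> < 1"
    using pos_divide_less_eq[of "sqrt (1 + t\<^sup>2)" "\<bar>t\<bar>" 1] by (simp add: add_pos_nonneg)
  moreover have "1 - (t / sqrt (1 + t\<^sup>2))\<^sup>2 = 1 / (1 + t\<^sup>2)"
  proof -
    have "1 + t\<^sup>2 \<noteq> 0"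
      by (metis add_pos_nonneg less_numeral_extra(1) less_numeral_extra(3) zero_le_power2)
    then show ?thesis by (simp add: power_divide field_simps)
  qed
  ultimately show ?thesis
    by (simp add: cot_def cos_arccos_abs sin_arccos_abs real_sqrt_divide add_nonneg_eq_0_iff)
qed

context tangent_circles
begin

lemma tan_half_internal_angle_A:
  shows "y * z > 0 \<Longrightarrow> tan (internal_angle A B C / 2) = \<bar>x\<bar>"
    and "y * z < 0 \<Longrightarrow> tan ((pi - internal_angle A B C) / 2) = \<bar>x\<bar>"
proof -
  define c where "c = (1 - x\<^sup>2) / (1 + x\<^sup>2)"
  have "\<bar>1 - x\<^sup>2\<bar> \<le> 1 + x\<^sup>2"
    by (smt (verit) zero_le_power2)
  then have c: "-1 \<le> c" "c \<le> 1"
    by (auto simp: c_def divide_simps abs_le_iff add_pos_nonneg)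
  have t: "tan (arccos c / 2) = \<bar>x\<bar>"
    using tan_half_arccos[of "\<bar>x\<bar>"] by (simp add: c_def)
  have a: "internal_angle A B C = arccos (sgn (y * z) * c)"
    by (simp add: internal_angle_def cos_internal_angle_A c_def)
  show "y * z > 0 \<Longrightarrow> tan (internal_angle A B C / 2) = \<bar>x\<bar>"
    using t by (simp only: a sgn_pos mult_1)
  show "y * z < 0 \<Longrightarrow> tan ((pi - internal_angle A B C) / 2) = \<bar>x\<bar>"
    using t c by (simp add: a arccos_minus)
qed

text \<open>
  The foot is the contact point of the circles around \<open>B\<close> and \<open>C\<close>, which divides the side in the
  ratio of the signed radii \<open>\<iota> / y\<close> and \<open>\<iota> / z\<close>.
\<close>
lemma foot_unique:
  assumes "foot_of_perpendicular I B C X"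
  shows "X = C + (y / (y + z)) *\<^sub>R (B - C)"
proof -
  obtain s where s: "X = C + s *\<^sub>R (B - C)"
  proof -
    have "X \<in> affine hull {C, B}"
      using assms by (simp add: foot_of_perpendicular_def insert_commute)
    then show ?thesis
      using that by (auto simp: affine_hull_2_alt)
  qed
  have BC': "(C - B) \<bullet> (C - B) = (\<iota> / y + \<iota> / z)\<^sup>2"
    using BC by (simp add: dist_norm norm_minus_commute flip: power2_norm_eq_inner)
  have "(I - C) - (I - B) = B - C" by simp
  then have "(I - C) \<bullet> (B - C) = ((dist I C)\<^sup>2 + (dist B C)\<^sup>2 - (dist I B)\<^sup>2) / 2"
    by (simp add: dot_norm_neg dist_norm algebra_simps)
  also have "\<dots> = (\<iota> / z) * (\<iota> / y + \<iota> / z)"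
    unfolding IB IC BC using nonzero by (simp add: field_simps power2_eq_square)
  finally have 1: "(I - C) \<bullet> (C - B) = - ((\<iota> / z) * (\<iota> / y + \<iota> / z))"
    by (metis inner_minus_right minus_diff_eq)
  have "(I - X) \<bullet> (C - B) = (I - C) \<bullet> (C - B) + s * ((C - B) \<bullet> (C - B))"
    by (simp add: s algebra_simps inner_diff inner_add)
  then have "s * (\<iota> / y + \<iota> / z)\<^sup>2 = (\<iota> / z) * (\<iota> / y + \<iota> / z)"
    using assms unfolding 1 BC' by (simp add: foot_of_perpendicular_def orthogonal_def)
  moreover have f: "\<iota> / y + \<iota> / z = \<iota> * (y + z) / (y * z)"
    using nonzero by (simp add: field_simps)
  moreover have "\<iota> * (y + z) / (y * z) \<noteq> 0"
    using sum_pair_pos(2) \<iota> nonzero by simp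
  moreover have "s * n = t" if "s * n\<^sup>2 = t * n" "n \<noteq> 0" for n t
    using that by (simp add: power2_eq_square)
  ultimately have "s * (\<iota> * (y + z) / (y * z)) = \<iota> / z"
    by metis
  then have "(\<iota> / z) * (s * (y + z) / y) = (\<iota> / z) * 1"
    by (simp add: mult_ac)
  then have "s * (y + z) / y = 1"
    using \<iota> nonzero by (simp only: mult_cancel_left) simp
  then have "s = y / (y + z)"
    using sum_pair_pos(2) nonzero by (simp add: field_simps)
  with s show ?thesis by simp
qed


text \<open>
  Two contact points lie on the circle around their common vertex \<open>C\<close>, of radius \<open>\<bar>\<iota> / z\<bar>\<close>, so the
  law of cosines at \<open>C\<close> gives their distance. Since the circumradius of the pedal triangle is
  \<open>\<iota>\<close>, the formula says that the sine of the opposite angle \<open>C'\<close> is \<open>1 / sqrt (1 + z\<^sup>2)\<close>.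
\<close>
lemma dist_feet:
  assumes "foot_of_perpendicular I B C A'" "foot_of_perpendicular I C A B'"
  shows "(dist A' B')\<^sup>2 = 4 * \<iota>\<^sup>2 / (1 + z\<^sup>2)"
proof -
  interpret B: tangent_circles B C A I \<iota> y z x by (rule rotate)
  interpret C: tangent_circles C A B I \<iota> z x y by (rule B.rotate)
  define \<alpha> \<beta> where "\<alpha> = y / (y + z)" and "\<beta> = x / (z + x)"
  have A': "A' = C + \<alpha> *\<^sub>R (B - C)"
    using foot_unique[OF assms(1)] by (simp add: \<alpha>_def)
  have \<beta>': "z / (z + x) = 1 - \<beta>"
    using sum_pair_pos by (simp add: \<beta>_def field_simps)
  have B': "B' = C + \<beta> *\<^sub>R (A - C)"
    using B.foot_unique[OF assms(2)] unfolding \<beta>' by (simp add: algebra_simps)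
  have BC': "(B - C) \<bullet> (B - C) = (\<iota> / y + \<iota> / z)\<^sup>2" and CA': "(A - C) \<bullet> (A - C) = (\<iota> / z + \<iota> / x)\<^sup>2"
    using BC CA by (simp_all add: dist_norm norm_minus_commute flip: power2_norm_eq_inner)
  have pos: "1 + z\<^sup>2 > 0" "z\<^sup>2 > 0"
    using nonzero by (simp_all add: add_pos_nonneg)
  have prod: "(y + z) * (z + x) = 1 + z\<^sup>2"
    using sum_products by (simp add: algebra_simps power2_eq_square)
  have "A' - B' = \<alpha> *\<^sub>R (B - C) - \<beta> *\<^sub>R (A - C)"
    by (simp add: A' B')
  then have "(dist A' B')\<^sup>2 = \<alpha>\<^sup>2 * ((B - C) \<bullet> (B - C)) + \<beta>\<^sup>2 * ((A - C) \<bullet> (A - C))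
      - 2 * ((\<alpha> * \<beta>) * ((A - C) \<bullet> (B - C)))"
    by (simp only: dist_norm power2_norm_diff_scaleR)
  moreover have "\<alpha>\<^sup>2 * ((B - C) \<bullet> (B - C)) = \<iota>\<^sup>2 / z\<^sup>2"
  proof -
    have "\<iota> / y + \<iota> / z = \<iota> * (y + z) / (y * z)"
      using nonzero by (simp add: field_simps)
    then have "\<alpha> * (\<iota> / y + \<iota> / z) = \<iota> / z"
      using sum_pair_pos nonzero by (simp add: \<alpha>_def)
    then show ?thesis
      unfolding BC' by (metis power_mult_distrib power_divide)
  qed
  moreover have "\<beta>\<^sup>2 * ((A - C) \<bullet> (A - C)) = \<iota>\<^sup>2 / z\<^sup>2"
  proof -
    have "\<iota> / z + \<iota> / x = \<iota> * (z + x) / (x * z)"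
      using nonzero by (simp add: field_simps)
    then have "\<beta> * (\<iota> / z + \<iota> / x) = \<iota> / z"
      using sum_pair_pos nonzero by (simp add: \<beta>_def)
    then show ?thesis
      unfolding CA' by (metis power_mult_distrib power_divide)
  qed
  moreover have "(\<alpha> * \<beta>) * ((A - C) \<bullet> (B - C)) = \<iota>\<^sup>2 * (1 - z\<^sup>2) / (z\<^sup>2 * (1 + z\<^sup>2))"
  proof -
    have "\<alpha> * \<beta> = x * y / (1 + z\<^sup>2)"
      by (simp add: \<alpha>_def \<beta>_def flip: prod)
    then show ?thesis
      unfolding C.inner_at_A using nonzero by simp
  qed
  ultimately have "(dist A' B')\<^sup>2 = 2 * (\<iota>\<^sup>2 / z\<^sup>2) - 2 * (\<iota>\<^sup>2 * (1 - z\<^sup>2) / (z\<^sup>2 * (1 + z\<^sup>2)))"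
    by simp
  also have "\<dots> = 4 * \<iota>\<^sup>2 / (1 + z\<^sup>2)"
  proof -
    have "2 * (i / w) - 2 * (i * (1 - w) / (w * (1 + w))) = 4 * i / (1 + w)" if "w > 0" for i w :: real
      using that by (simp add: divide_simps add_pos_pos) (simp add: algebra_simps)
    from this[OF pos(2)] show ?thesis .
  qed
  finally show ?thesis .
qed

text \<open>
  The sine of \<open>A'\<close> does not determine whether \<open>A'\<close> is obtuse, so the cosine is computed from the three
  sides; its sign is that of \<open>x\<close>.
\<close>
lemma cot_pedal_angle_A:
  assumes "pedal_triangle I A B C A' B' C'"
  shows "cot (internal_angle A' B' C') = x"
proof -
  interpret B: tangent_circles B C A I \<iota> y z x by (rule rotate)
  interpret C: tangent_circles C A B I \<iota> z x y by (rule B.rotate)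
  define a b c where "a = y + z" and "b = z + x" and "c = x + y"
  have pos: "a > 0" "b > 0" "c > 0"
    using sum_pair_pos by (simp_all add: a_def b_def c_def)
  have p: "1 + x\<^sup>2 = b * c" and q: "1 + y\<^sup>2 = c * a" and r: "1 + z\<^sup>2 = a * b"
    using sum_products by (simp_all add: a_def b_def c_def algebra_simps power2_eq_square)
  have A'B': "(dist A' B')\<^sup>2 = 4 * \<iota>\<^sup>2 / (a * b)"
    and B'C': "(dist B' C')\<^sup>2 = 4 * \<iota>\<^sup>2 / (b * c)"
    and C'A': "(dist C' A')\<^sup>2 = 4 * \<iota>\<^sup>2 / (c * a)"
    using assms dist_feet B.dist_feet C.dist_feet
    by (simp_all add: pedal_triangle_def flip: p q r)
  have "B' - C' = (B' - A') - (C' - A')" by simp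
  then have "(B' - A') \<bullet> (C' - A') = ((dist A' B')\<^sup>2 + (dist C' A')\<^sup>2 - (dist B' C')\<^sup>2) / 2"
    by (simp only: dist_norm norm_minus_commute[of A' B']) (simp add: dot_norm_neg)
  also have "\<dots> = 2 * \<iota>\<^sup>2 * (b + c - a) / (a * b * c)"
    unfolding A'B' B'C' C'A' using pos by (simp add: field_simps)
  finally have inner: "(B' - A') \<bullet> (C' - A') = 4 * \<iota>\<^sup>2 * x / (a * b * c)"
    by (simp add: a_def b_def c_def)
  have "dist A' B' * dist C' A' = sqrt ((4 * \<iota>\<^sup>2 / (a * b)) * (4 * \<iota>\<^sup>2 / (c * a)))"
    unfolding A'B'[symmetric] C'A'[symmetric] by (simp add: real_sqrt_mult)
  also have "(4 * \<iota>\<^sup>2 / (a * b)) * (4 * \<iota>\<^sup>2 / (c * a)) = (4 * \<iota>\<^sup>2 / a)\<^sup>2 / (b * c)"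
    by (simp add: power2_eq_square)
  also have "sqrt \<dots> = 4 * \<iota>\<^sup>2 / (a * sqrt (b * c))"
    using pos by (simp add: real_sqrt_divide)
  finally have norms: "norm (B' - A') * norm (C' - A') = 4 * \<iota>\<^sup>2 / (a * sqrt (b * c))"
    by (simp add: dist_norm norm_minus_commute)
  have "((B' - A') \<bullet> (C' - A')) / (norm (B' - A') * norm (C' - A')) = x * sqrt (b * c) / (b * c)"
    unfolding inner norms using pos \<iota> by (simp add: field_simps)
  also have "\<dots> = x / sqrt (b * c)"
    using pos by (simp add: real_div_sqrt field_simps)
  finally show ?thesis
    by (simp add: internal_angle_def cot_arccos flip: p)
qed

text \<open>
  The three cases of the sign convention correspond to the only possible sign patterns, because at
  most one of \<open>x, y, z\<close> is negative.
\<close>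
lemma half_angle_tan_A:
  assumes AB': "on_different_branches \<F> A B \<longleftrightarrow> x * y < 0"
    and BC': "on_different_branches \<F> B C \<longleftrightarrow> y * z < 0"
    and AC': "on_different_branches \<F> A C \<longleftrightarrow> x * z < 0"
  shows "half_angle_tan \<F> A B C = x"
proof -
  have "y * z \<noteq> 0" "x \<noteq> 0"
    using nonzero by simp_all
  moreover have "x > 0" if "y * z < 0"
    using that sum_pair_pos nonzero(1) by (auto simp: mult_less_0_iff)
  moreover have "x * y < 0 \<and> x * z < 0 \<longleftrightarrow> x < 0" if "y * z > 0"
    using that sum_pair_pos by (auto simp: zero_less_mult_iff mult_less_0_iff)
  ultimately consider "y * z < 0" "x > 0" | "y * z > 0" "x > 0" "\<not> (x * y < 0 \<and> x * z < 0)"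
    | "y * z > 0" "x < 0" "x * y < 0 \<and> x * z < 0"
    by linarith
  then show ?thesis
    using tan_half_internal_angle_A
    by cases (simp_all add: half_angle_tan_def AB' BC' AC')
qed

lemma sum_squares: "x\<^sup>2 + y\<^sup>2 + z\<^sup>2 = (x + y + z)\<^sup>2 - 2"
proof -
  have "(x + y + z)\<^sup>2 = x\<^sup>2 + y\<^sup>2 + z\<^sup>2 + 2 * (x * y + y * z + z * x)"
    by (simp add: power2_eq_square algebra_simps)
  then show ?thesis
    by (simp add: sum_products)
qed

end

section \<open>Powers of the circles of the chain\<close>

abbreviation chain_power :: "complex \<Rightarrow> complex \<Rightarrow> real \<Rightarrow> real \<Rightarrow> real" where
  "chain_power P Q r \<theta> \<equiv> point_power P (equilateral_vertex Q r \<theta>) r"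

abbreviation chain_vertex :: "complex \<Rightarrow> real \<Rightarrow> complex \<Rightarrow> real \<Rightarrow> real \<Rightarrow> complex" where
  "chain_vertex P k Q r \<theta> \<equiv> inverse_centre P k (equilateral_vertex Q r \<theta>) r"

lemma inner_cis: "cis a \<bullet> cis b = cos (a - b)"
  by (simp add: inner_complex_def cos_diff)

lemma power2_norm_cis_diff: "(norm (cis a - cis b))\<^sup>2 = 2 - 2 * cos (a - b)"
  using power2_norm_diff_scaleR[of 1 "cis a" 1 "cis b"] by (simp add: inner_cis cos_diff mult.commute)

lemma power2_circumradius: "(2 * r / sqrt 3)\<^sup>2 = 4 * r\<^sup>2 / 3"
  by (simp add: power_divide power_mult_distrib)

lemma dist_equilateral_vertices:
  "(dist (equilateral_vertex Q r \<theta>) (equilateral_vertex Q r \<theta>'))\<^sup>2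
    = 4 * r\<^sup>2 / 3 * (2 - 2 * cos (\<theta> - \<theta>'))"
proof -
  have "equilateral_vertex Q r \<theta> - equilateral_vertex Q r \<theta>'
    = complex_of_real (2 * r / sqrt 3) * (cis \<theta> - cis \<theta>')"
    by (simp only: equilateral_vertex_def add_diff_cancel_left right_diff_distrib)
  then have "(dist (equilateral_vertex Q r \<theta>) (equilateral_vertex Q r \<theta>'))\<^sup>2
    = (2 * r / sqrt 3)\<^sup>2 * (norm (cis \<theta> - cis \<theta>'))\<^sup>2"
    by (simp only: dist_norm norm_mult norm_of_real power_mult_distrib power2_abs)
  then show ?thesis
    by (simp only: power2_circumradius power2_norm_cis_diff)
qed

lemma dist_equilateral_vertex_centre:
  "(dist Q (equilateral_vertex Q r \<theta>))\<^sup>2 = 4 * r\<^sup>2 / 3"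
  by (simp only: equilateral_vertex_def dist_norm norm_minus_commute[of Q] add_diff_cancel_left'
      norm_mult norm_cis norm_of_real mult_1_right power2_abs power2_circumradius)

lemma cos_120_shift:
  "cos (x + 2 * pi / 3) = - cos x / 2 - sqrt 3 / 2 * sin x"
  "cos (x + 4 * pi / 3) = - cos x / 2 + sqrt 3 / 2 * sin x"
proof -
  have "4 * pi / 3 = pi + pi / 3" "2 * pi / 3 = pi - pi / 3" by simp_all
  then show "cos (x + 2 * pi / 3) = - cos x / 2 - sqrt 3 / 2 * sin x"
  "cos (x + 4 * pi / 3) = - cos x / 2 + sqrt 3 / 2 * sin x"
    by (simp_all only: cos_add sin_add cos_diff sin_diff cos_pi sin_pi cos_60 sin_60) simp_all
qed

lemma chain_power_cos:
  obtains \<phi> where "\<And>\<theta>. chain_power P Q r \<theta>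
    = (dist P Q)\<^sup>2 + r\<^sup>2 / 3 + 4 * r / sqrt 3 * dist P Q * cos (\<theta> - \<phi>)"
proof
  fix \<theta>
  define \<phi> where "\<phi> = Arg (Q - P)"
  have "Q - P = complex_of_real (dist P Q) * cis \<phi>"
    using rcis_cmod_Arg[of "Q - P"] by (simp add: rcis_def \<phi>_def dist_norm norm_minus_commute)
  then have e: "equilateral_vertex Q r \<theta> - P
      = complex_of_real (dist P Q) * cis \<phi> - complex_of_real (- (2 * r / sqrt 3)) * cis \<theta>"
    by (simp add: equilateral_vertex_def algebra_simps)
  have "(dist (equilateral_vertex Q r \<theta>) P)\<^sup>2
      = (norm (dist P Q *\<^sub>R cis \<phi> - (- (2 * r / sqrt 3)) *\<^sub>R cis \<theta>))\<^sup>2"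
    unfolding scaleR_conv_of_real by (simp only: dist_norm[of _ P] e)
  also have "\<dots> = (dist P Q)\<^sup>2 + (2 * r / sqrt 3)\<^sup>2 + 4 * r / sqrt 3 * dist P Q * cos (\<theta> - \<phi>)"
    unfolding power2_norm_diff_scaleR inner_cis by simp
  finally show "chain_power P Q r \<theta>
    = (dist P Q)\<^sup>2 + r\<^sup>2 / 3 + 4 * r / sqrt 3 * dist P Q * cos (\<theta> - Arg (Q - P))"
    unfolding point_power_def power2_circumradius \<phi>_def by simp
qed

text \<open>
  The three values of \<open>cos\<close> at angles 120 degrees apart have sum \<open>0\<close> and sum of pair products
  \<open>- 3 / 4\<close>. So both symmetric functions of the powers are independent of \<open>\<theta>\<close>. The second turns out
  to be three times the square of the power of \<open>P\<close> with respect to the incircle of the equilateral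
  triangle, which is what makes the pair products of the half-angle tangents sum to \<open>1\<close>.
\<close>
lemma chain_power_sums:
  fixes P Q :: complex and r \<theta> :: real
  defines "p \<equiv> chain_power P Q r \<theta>" and "q \<equiv> chain_power P Q r (\<theta> + 2 * pi / 3)"
    and "s \<equiv> chain_power P Q r (\<theta> + 4 * pi / 3)"
  shows "p + q + s = 3 * ((dist P Q)\<^sup>2 + r\<^sup>2 / 3)"
    and "p * q + q * s + s * p = 3 * (point_power P Q (r / sqrt 3))\<^sup>2"
proof -
  obtain \<phi> where w: "\<And>\<theta>. chain_power P Q r \<theta>
      = (dist P Q)\<^sup>2 + r\<^sup>2 / 3 + 4 * r / sqrt 3 * dist P Q * cos (\<theta> - \<phi>)"
    using chain_power_cos by metis
  define m n c t where "m = (dist P Q)\<^sup>2 + r\<^sup>2 / 3" and "n = 4 * r / sqrt 3 * dist P Q"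
    and "c = cos (\<theta> - \<phi>)" and "t = sqrt 3 * sin (\<theta> - \<phi>)"
  have sh: "\<theta> + a - \<phi> = (\<theta> - \<phi>) + a" for a by simp
  have p: "p = m + n * c" and q: "q = m + n * (- c / 2 - t / 2)" and s: "s = m + n * (- c / 2 + t / 2)"
    unfolding p_def q_def s_def w sh cos_120_shift by (simp_all add: m_def n_def c_def t_def)
  show "p + q + s = 3 * ((dist P Q)\<^sup>2 + r\<^sup>2 / 3)"
    by (simp add: p q s field_simps) (simp add: m_def)
  have t2: "t\<^sup>2 = 3 * (1 - c\<^sup>2)"
    by (simp add: t_def c_def power_mult_distrib sin_squared_eq)
  have n2: "n\<^sup>2 = 16 * r\<^sup>2 / 3 * (dist P Q)\<^sup>2"
    by (simp add: n_def power_mult_distrib power_divide)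
  have "p * q + q * s + s * p = 3 * m\<^sup>2 - n\<^sup>2 * (3 * c\<^sup>2 + t\<^sup>2) / 4"
    by (simp add: p q s field_simps power2_eq_square)
  also have "\<dots> = 3 * m\<^sup>2 - 4 * r\<^sup>2 * (dist P Q)\<^sup>2"
    unfolding t2 n2 by simp
  also have "\<dots> = 3 * (point_power P Q (r / sqrt 3))\<^sup>2"
    by (simp add: m_def point_power_def dist_commute power_divide) (simp add: power2_eq_square field_simps)
  finally show "p * q + q * s + s * p = 3 * (point_power P Q (r / sqrt 3))\<^sup>2" .
qed


section \<open>Branches of the hyperbola and signs of the powers\<close>

text \<open>
  The circles of the chain touch the two Soddy circles, the images of the circles around \<open>Q\<close> with
  radii \<open>R + r\<close> (from inside) and \<open>R - r\<close> (from outside). So the distances of a vertex from their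
  centres are \<open>\<bar>\<rho> - \<rho>1\<bar>\<close> and \<open>\<bar>\<rho> + \<rho>2\<bar>\<close>, where \<open>\<rho>, \<rho>1, \<rho>2\<close> are the signed radii. When \<open>P\<close> is inside one
  of the circles of the chain, it lies between the two concentric circles, whence
  \<open>\<rho>1 < 0 < \<rho>2\<close>, and both \<open>\<rho> - \<rho>1\<close> and \<open>\<rho> + \<rho>2\<close> have the sign of \<open>\<rho>\<close>. The difference of the distances
  is therefore \<open>\<plusminus> (\<rho>1 + \<rho>2)\<close>, with the sign of \<open>\<rho>\<close>.
\<close>
lemma soddy_centres_separate_vertices:
  fixes P Q :: complex and k r :: real
  assumes k: "k > 0" and r: "r > 0" and w0: "point_power P Q (r / sqrt 3) \<noteq> 0"
    and neg: "chain_power P Q r \<theta>0 < 0"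
  obtains F G c where "0 < c" "c < dist F G"
    "\<And>\<theta>. chain_power P Q r \<theta> \<noteq> 0 \<Longrightarrow>
       dist (chain_vertex P k Q r \<theta>) G - dist (chain_vertex P k Q r \<theta>) F = sgn (chain_power P Q r \<theta>) * c"
proof -
  define R where "R = 2 * r / sqrt 3"
  have R2: "R\<^sup>2 = 4 * r\<^sup>2 / 3"
    unfolding R_def by (rule power2_circumradius)
  have "r\<^sup>2 < R\<^sup>2" using r by (simp add: R2)
  moreover have "R > 0" using r by (simp add: R_def)
  ultimately have R: "R > r" by (simp add: power2_less_imp_less)
  define W1 W2 where "W1 = point_power P Q (R + r)" and "W2 = point_power P Q (R - r)"
  define D where "D = (dist Q P)\<^sup>2"
  define O1 O2 where "O1 = inverse_centre P k Q (R + r)" and "O2 = inverse_centre P k Q (R - r)"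
  define \<rho>1 \<rho>2 where "\<rho>1 = inverse_radius P k Q (R + r)" and "\<rho>2 = inverse_radius P k Q (R - r)"
  have W: "W1 = D - (R + r)\<^sup>2" "W2 = D - (R - r)\<^sup>2"
    by (simp_all add: W1_def W2_def D_def point_power_def)
  have W1: "W1 < 0" and W2: "W2 > 0"
  proof -
    define c where "c = equilateral_vertex Q r \<theta>0"
    have "(dist c P)\<^sup>2 < r\<^sup>2"
      using neg by (simp add: point_power_def c_def)
    then have "dist c P < r"
      using r by (simp add: power2_less_imp_less)
    moreover have "dist Q c = R"
      using dist_equilateral_vertex_centre[of Q r \<theta>0] \<open>R > 0\<close> unfolding R2[symmetric] c_def
      by (simp add: power2_eq_iff_nonneg)
    ultimately have "dist Q P < R + r" "R - r < dist Q P"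
      using dist_triangle[of Q P c] dist_triangle[of Q c P] by (simp_all add: dist_commute)
    then show "W1 < 0" "W2 > 0"
      unfolding W1_def W2_def point_power_def using R r
      by (simp_all add: power_strict_mono)
  qed
  have sum: "\<rho>1 + \<rho>2 = k\<^sup>2 * (2 * R * point_power P Q (r / sqrt 3)) / (W1 * W2)"
  proof -
    have "(R + r) * W2 + (R - r) * W1 = 2 * R * (D - (R\<^sup>2 - r\<^sup>2))"
      by (simp add: W power2_eq_square algebra_simps)
    also have "D - (R\<^sup>2 - r\<^sup>2) = point_power P Q (r / sqrt 3)"
      by (simp add: R2 D_def point_power_def power_divide)
    finally have "k\<^sup>2 * ((R + r) * W2 + (R - r) * W1) / (W1 * W2)
        = k\<^sup>2 * (2 * R * point_power P Q (r / sqrt 3)) / (W1 * W2)"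
      by simp
    moreover have "\<rho>1 + \<rho>2 = k\<^sup>2 * ((R + r) * W2 + (R - r) * W1) / (W1 * W2)"
      using W1 W2 by (simp add: \<rho>1_def \<rho>2_def inverse_radius_def field_simps flip: W1_def W2_def)
    ultimately show ?thesis by simp
  qed
  \<comment> \<open>Only for \<open>P\<close> on the incircle of the equilateral triangle, where the circle of contact points
    becomes a line, would the two Soddy circles have equal radii and the hyperbola degenerate.\<close>
  then have nz: "\<rho>1 + \<rho>2 \<noteq> 0"
    using k R r w0 W1 W2 by simp
  have nzp: "point_power P Q (R + r) \<noteq> 0" "point_power P Q (R - r) \<noteq> 0"
    using W1 W2 by (simp_all add: W1_def W2_def)
  have "(dist O1 O2)\<^sup>2 = \<rho>1\<^sup>2 + \<rho>2\<^sup>2 + k ^ 4 * (0 - (R + r)\<^sup>2 - (R - r)\<^sup>2) / (W1 * W2)"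
    using dist_inverse_centres[OF nzp, of k]
    by (simp add: O1_def O2_def \<rho>1_def \<rho>2_def W1_def W2_def)
  moreover have "(\<rho>1 + \<rho>2)\<^sup>2 = \<rho>1\<^sup>2 + \<rho>2\<^sup>2 + k ^ 4 * (2 * (R + r) * (R - r)) / (W1 * W2)"
    unfolding power2_sum
    by (simp add: \<rho>1_def \<rho>2_def W1_def W2_def inverse_radius_def power2_eq_square power4_eq_xxxx)
  ultimately have "(dist O1 O2)\<^sup>2 - (\<rho>1 + \<rho>2)\<^sup>2
      = k ^ 4 * (0 - (R + r)\<^sup>2 - (R - r)\<^sup>2) / (W1 * W2) - k ^ 4 * (2 * (R + r) * (R - r)) / (W1 * W2)"
    by simp
  also have "\<dots> = k ^ 4 * ((0 - (R + r)\<^sup>2 - (R - r)\<^sup>2) - 2 * (R + r) * (R - r)) / (W1 * W2)"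
    by (simp only: right_diff_distrib diff_divide_distrib)
  also have "(0 - (R + r)\<^sup>2 - (R - r)\<^sup>2) - 2 * (R + r) * (R - r) = - (4 * R\<^sup>2)"
    by (simp add: power2_eq_square algebra_simps)
  finally have "(dist O1 O2)\<^sup>2 - (\<rho>1 + \<rho>2)\<^sup>2 = - (k ^ 4 * (4 * R\<^sup>2) / (W1 * W2))"
    by simp
  moreover have "- (k ^ 4 * (4 * R\<^sup>2) / (W1 * W2)) > 0"
    using k \<open>R > 0\<close> W1 W2 by (simp add: divide_pos_neg mult_neg_pos)
  ultimately have "\<bar>\<rho>1 + \<rho>2\<bar>\<^sup>2 < (dist O1 O2)\<^sup>2"
    by simp
  then have lt: "\<bar>\<rho>1 + \<rho>2\<bar> < dist O1 O2"
    by (rule power2_less_imp_less) simp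
  have diff: "dist X O2 - dist X O1 = sgn w * (\<rho>1 + \<rho>2)"
    if w: "w = chain_power P Q r \<theta>" "w \<noteq> 0" and X: "X = chain_vertex P k Q r \<theta>" for X w \<theta>
  proof -
    define c where "c = equilateral_vertex Q r \<theta>"
    define \<rho> where "\<rho> = inverse_radius P k c r"
    define e where "e = (Q - P) \<bullet> cis \<theta>"
    have Qc: "(dist Q c)\<^sup>2 = R\<^sup>2"
      unfolding c_def R2 by (rule dist_equilateral_vertex_centre)
    have nsq: "(norm (1 *\<^sub>R (Q - P) - (- a) *\<^sub>R cis \<theta>))\<^sup>2 = D + a\<^sup>2 + 2 * a * e" for a
    proof -
      show ?thesis
        unfolding power2_norm_diff_scaleR inner_cis
        by (simp add: D_def e_def dist_norm inner_commute flip: power2_norm_eq_inner)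
    qed
    have "c - P = 1 *\<^sub>R (Q - P) - (- R) *\<^sub>R cis \<theta>"
      by (simp add: c_def equilateral_vertex_def R_def scaleR_conv_of_real)
    then have w': "w = D + R\<^sup>2 - r\<^sup>2 + 2 * R * e"
      unfolding w(1) point_power_def c_def[symmetric] dist_norm by (simp only: nsq)
    \<comment> \<open>For \<open>a = R + r\<close> and \<open>a = R - r\<close> this is the squared distance from \<open>P\<close> to the contact points
      of the chain circle with the outer and the inner circle.\<close>
    have N: "D + a\<^sup>2 + 2 * a * e \<ge> 0" for a
      unfolding nsq[symmetric] by simp
    have nzc: "point_power P c r \<noteq> 0"
      using w by (simp add: c_def)
    have "(dist X O1)\<^sup>2 = (\<rho> - \<rho>1)\<^sup>2"
      using dist_inverse_centres_tangent[of P c r Q "- (R + r)" k] nzc nzp(1) Qc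
      unfolding inverse_minus_radius by (simp add: X O1_def \<rho>_def \<rho>1_def c_def dist_commute)
    then have d1: "dist X O1 = \<bar>\<rho> - \<rho>1\<bar>"
      by (rule dist_eq_abs)
    have "(dist X O2)\<^sup>2 = (\<rho> + \<rho>2)\<^sup>2"
      using dist_inverse_centres_tangent[of P c r Q "R - r" k] nzc nzp(2) Qc
      by (simp add: X O2_def \<rho>_def \<rho>2_def c_def dist_commute)
    then have d2: "dist X O2 = \<bar>\<rho> + \<rho>2\<bar>"
      by (rule dist_eq_abs)
    have abs_eq: "\<bar>q\<bar> = sgn w * q" if "q = a / w" "a \<ge> 0" for q a
      using that w(2) by (cases "w > 0") (simp_all add: divide_nonneg_neg)
    have \<rho>: "\<rho> = k\<^sup>2 * r / w" "\<rho>1 = k\<^sup>2 * (R + r) / W1" "\<rho>2 = k\<^sup>2 * (R - r) / W2"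
      by (simp_all add: \<rho>_def \<rho>1_def \<rho>2_def inverse_radius_def w c_def W1_def W2_def)
    have "\<rho> - \<rho>1 = k\<^sup>2 * (r * W1 - (R + r) * w) / (w * W1)"
      unfolding \<rho> using w(2) W1 by (simp add: field_simps)
    also have "r * W1 - (R + r) * w = - (R * (D + (R + r)\<^sup>2 + 2 * (R + r) * e))"
      by (simp add: W w' power2_eq_square algebra_simps)
    finally have "\<rho> - \<rho>1 = (k\<^sup>2 * R * (D + (R + r)\<^sup>2 + 2 * (R + r) * e) / - W1) / w"
      using w(2) W1 by (simp add: field_simps)
    moreover have "k\<^sup>2 * R * (D + (R + r)\<^sup>2 + 2 * (R + r) * e) / - W1 \<ge> 0"
      using N[of "R + r"] \<open>R > 0\<close> W1 by (intro divide_nonneg_pos mult_nonneg_nonneg) auto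
    ultimately have d1': "dist X O1 = sgn w * (\<rho> - \<rho>1)"
      unfolding d1 by (rule abs_eq)
    have "\<rho> + \<rho>2 = k\<^sup>2 * (r * W2 + (R - r) * w) / (w * W2)"
      unfolding \<rho> using w(2) W2 by (simp add: field_simps)
    also have "r * W2 + (R - r) * w = R * (D + (R - r)\<^sup>2 + 2 * (R - r) * e)"
      by (simp add: W w' power2_eq_square algebra_simps)
    finally have "\<rho> + \<rho>2 = (k\<^sup>2 * R * (D + (R - r)\<^sup>2 + 2 * (R - r) * e) / W2) / w"
      using w(2) W2 by (simp add: field_simps)
    moreover have "k\<^sup>2 * R * (D + (R - r)\<^sup>2 + 2 * (R - r) * e) / W2 \<ge> 0"
      using N[of "R - r"] \<open>R > 0\<close> W2 by (intro divide_nonneg_pos mult_nonneg_nonneg) auto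
    ultimately have d2': "dist X O2 = sgn w * (\<rho> + \<rho>2)"
      unfolding d2 by (rule abs_eq)
    show ?thesis
      unfolding d1' d2' by (simp add: algebra_simps)
  qed
  show thesis
  proof (cases "\<rho>1 + \<rho>2 > 0")
    case True
    show thesis
      using that[of "\<rho>1 + \<rho>2" O1 O2] True lt diff by simp
  next
    case False
    show thesis
      using that[of "- (\<rho>1 + \<rho>2)" O2 O1] False nz lt diff by (simp add: dist_commute algebra_simps)
  qed
qed

text \<open>
  Positions with a line instead of a circle are not in the family. They are few enough to be
  ignored in the continuity argument below.
\<close>
lemma countable_chain_power_zero:
  assumes "r > 0"
  shows "countable {\<theta>. chain_power P Q r \<theta> = 0}"
proof (cases "\<exists>\<theta>0. chain_power P Q r \<theta>0 = 0")
  case False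
  then show ?thesis by simp
next
  case True
  then obtain \<theta>0 where z: "chain_power P Q r \<theta>0 = 0" ..
  obtain \<phi> where w: "\<And>\<theta>. chain_power P Q r \<theta>
      = (dist P Q)\<^sup>2 + r\<^sup>2 / 3 + 4 * r / sqrt 3 * dist P Q * cos (\<theta> - \<phi>)"
    using chain_power_cos by metis
  have "4 * r / sqrt 3 * dist P Q \<noteq> 0"
  proof
    assume 0: "4 * r / sqrt 3 * dist P Q = 0"
    have "(dist P Q)\<^sup>2 + r\<^sup>2 / 3 = 0"
      using w[of \<theta>0] unfolding 0 z by simp
    then show False
      using assms by (simp add: add_nonneg_eq_0_iff)
  qed
  then have eq: "cos (\<theta> - \<phi>) = cos (\<theta>0 - \<phi>)" if "chain_power P Q r \<theta> = 0" for \<theta>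
    using that z w[of \<theta>] w[of \<theta>0] by (metis add_left_cancel mult_left_cancel)
  have "{\<theta>. chain_power P Q r \<theta> = 0} \<subseteq>
      range (\<lambda>n::int. \<phi> + (\<theta>0 - \<phi>) + 2 * of_int n * pi) \<union> range (\<lambda>n::int. \<phi> - (\<theta>0 - \<phi>) + 2 * of_int n * pi)"
  proof
    fix \<theta>
    assume "\<theta> \<in> {\<theta>. chain_power P Q r \<theta> = 0}"
    then obtain n :: int where "\<theta> - \<phi> = (\<theta>0 - \<phi>) + 2 * of_int n * pi \<or> \<theta> - \<phi> = - (\<theta>0 - \<phi>) + 2 * of_int n * pi"
      using eq[of \<theta>] unfolding cos_eq by (auto elim: Ints_cases)
    then have "\<theta> = \<phi> + (\<theta>0 - \<phi>) + 2 * of_int n * pi \<or> \<theta> = \<phi> - (\<theta>0 - \<phi>) + 2 * of_int n * pi"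
      by linarith
    then show "\<theta> \<in> range (\<lambda>n::int. \<phi> + (\<theta>0 - \<phi>) + 2 * of_int n * pi) \<union> range (\<lambda>n::int. \<phi> - (\<theta>0 - \<phi>) + 2 * of_int n * pi)"
      by (auto simp: image_iff)
  qed
  then show ?thesis
    by (rule countable_subset) auto
qed

text \<open>
  By the intermediate value theorem a sign change would make \<open>g\<close> take all values between \<open>- c\<close> and \<open>c\<close>.
  There are uncountably many of them, whereas \<open>g\<close> has only countably many values.
\<close>
lemma continuous_abs_const_no_sign_change:
  fixes g :: "'a::topological_space \<Rightarrow> real"
  assumes "connected S" "continuous_on S g" "countable N" "c > 0"
    and vals: "\<And>t. t \<in> S \<Longrightarrow> t \<notin> N \<Longrightarrow> \<bar>g t\<bar> = c"
    and "a \<in> S" "g a = c" "b \<in> S"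
  shows "g b \<noteq> - c"
proof
  assume "g b = - c"
  have "connected (g ` S)"
    using assms(1,2) by (intro connected_continuous_image)
  moreover have "- c \<in> g ` S" "c \<in> g ` S"
    using \<open>g a = c\<close> \<open>g b = - c\<close> \<open>a \<in> S\<close> \<open>b \<in> S\<close> by (metis imageI)+
  ultimately have "{- c..c} \<subseteq> g ` S"
    by (rule connected_contains_Icc)
  also have "g ` S \<subseteq> {c, - c} \<union> g ` N"
  proof
    fix y
    assume "y \<in> g ` S"
    then obtain t where t: "t \<in> S" "y = g t" by blast
    have "\<bar>g t\<bar> = c" if "t \<notin> N"
      using vals t(1) that .
    then show "y \<in> {c, - c} \<union> g ` N"
      using t(2) by (cases "t \<in> N") (auto simp: abs_if split: if_splits)
  qed
  finally have "countable {- c..c}"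
    by (rule countable_subset) (simp add: \<open>countable N\<close>)
  then show False
    using \<open>c > 0\<close> uncountable_closed_interval[of "- c" c] by simp
qed

lemma cos_ge_on_segment:
  assumes "\<bar>a\<bar> \<le> pi" "\<bar>b\<bar> \<le> pi" "t \<in> closed_segment a b"
  shows "min (cos a) (cos b) \<le> cos t"
proof -
  have t: "\<bar>t\<bar> \<le> max \<bar>a\<bar> \<bar>b\<bar>"
    using assms(3) by (auto simp: closed_segment_eq_real_ivl split: if_splits)
  then have "cos (max \<bar>a\<bar> \<bar>b\<bar>) \<le> cos \<bar>t\<bar>"
    using assms(1,2) by (intro cos_monotone_0_pi_le) auto
  then show ?thesis
    by (auto simp: max_def min_def split: if_splits)
qed

lemma equilateral_vertex_angle_mod:
  obtains a where "\<bar>a\<bar> \<le> pi" "cis (\<phi> + a) = cis \<theta>"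
proof
  let ?a = "Arg (cis (\<theta> - \<phi>))"
  show "\<bar>?a\<bar> \<le> pi"
    using Arg_bounded[of "cis (\<theta> - \<phi>)"] by auto
  have "cis ?a = cis (\<theta> - \<phi>)"
    by (simp add: cis_Arg)
  then show "cis (\<phi> + ?a) = cis \<theta>"
    by (metis add_diff_cancel_left' add_diff_eq cis_mult)
qed

text \<open>
  The foci \<open>F, G\<close> are those of an arbitrary hyperbola through all triangles of the family. The angles
  with a positive power form an arc around \<open>\<phi>\<close>, the angle at which the power is greatest; along
  this arc the difference of the distances to the foci is continuous.
\<close>
lemma same_sign_same_branch:
  assumes r: "r > 0" and c: "c > 0"
    and good: "\<And>\<theta>. chain_power P Q r \<theta> \<noteq> 0 \<Longrightarrow> chain_power P Q r (\<theta> + 2 * pi / 3) \<noteq> 0 \<Longrightarrow>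
      chain_power P Q r (\<theta> + 4 * pi / 3) \<noteq> 0 \<Longrightarrow>
      \<bar>dist (chain_vertex P k Q r \<theta>) G - dist (chain_vertex P k Q r \<theta>) F\<bar> = c"
    and pos: "chain_power P Q r \<theta>1 > 0" "chain_power P Q r \<theta>2 > 0"
    and X: "dist (chain_vertex P k Q r \<theta>1) G - dist (chain_vertex P k Q r \<theta>1) F = c"
  shows "dist (chain_vertex P k Q r \<theta>2) G - dist (chain_vertex P k Q r \<theta>2) F \<noteq> - c"
proof -
  obtain \<phi> where w: "\<And>\<theta>. chain_power P Q r \<theta>
      = (dist P Q)\<^sup>2 + r\<^sup>2 / 3 + 4 * r / sqrt 3 * dist P Q * cos (\<theta> - \<phi>)"
    using chain_power_cos by metis
  define n where "n = 4 * r / sqrt 3 * dist P Q"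
  have n: "n \<ge> 0"
    using r by (simp add: n_def)
  obtain a b where a: "\<bar>a\<bar> \<le> pi" "cis (\<phi> + a) = cis \<theta>1" and b: "\<bar>b\<bar> \<le> pi" "cis (\<phi> + b) = cis \<theta>2"
    using equilateral_vertex_angle_mod by metis
  have ev: "equilateral_vertex Q r (\<phi> + a) = equilateral_vertex Q r \<theta>1"
    "equilateral_vertex Q r (\<phi> + b) = equilateral_vertex Q r \<theta>2"
    unfolding equilateral_vertex_def a(2) b(2) by simp_all
  define v where "v t = chain_vertex P k Q r (\<phi> + t)" for t
  define g where "g t = dist (v t) G - dist (v t) F" for t
  define S where "S = closed_segment a b"
  have posS: "chain_power P Q r (\<phi> + t) > 0" if "t \<in> S" for t
  proof -
    have "min (cos a) (cos b) \<le> cos t"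
      using that a(1) b(1) by (intro cos_ge_on_segment) (auto simp: S_def)
    then have "n * cos a \<le> n * cos t \<or> n * cos b \<le> n * cos t"
      using n by (auto simp: min_le_iff_disj intro: mult_left_mono)
    moreover have "chain_power P Q r (\<phi> + a) > 0" "chain_power P Q r (\<phi> + b) > 0"
      unfolding ev by (fact pos)+
    ultimately show ?thesis
      unfolding w n_def[symmetric] by auto
  qed
  define Z where "Z = {\<theta>. chain_power P Q r \<theta> = 0}"
  define N where "N = (\<lambda>\<theta>. \<theta> - \<phi>) ` Z \<union> (\<lambda>\<theta>. \<theta> - 2 * pi / 3 - \<phi>) ` Z \<union> (\<lambda>\<theta>. \<theta> - 4 * pi / 3 - \<phi>) ` Z"
  have "countable N"
    using countable_chain_power_zero[OF r] by (simp add: N_def Z_def)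
  moreover have "\<bar>g t\<bar> = c" if "t \<notin> N" for t
  proof -
    have "\<phi> + t \<notin> Z" "\<phi> + t + 2 * pi / 3 \<notin> Z" "\<phi> + t + 4 * pi / 3 \<notin> Z"
      using that unfolding N_def by (force simp: image_iff)+
    then show ?thesis
      using good[of "\<phi> + t"] by (simp add: Z_def g_def v_def)
  qed
  moreover have "continuous_on S g"
  proof -
    have "continuous_on S (\<lambda>t. equilateral_vertex Q r (\<phi> + t))"
      unfolding equilateral_vertex_def by (intro continuous_intros)
    then have "continuous_on S v"
      unfolding v_def inverse_centre_def point_power_def using posS
      by (intro continuous_intros) (force simp: point_power_def)+
    then show ?thesis
      unfolding g_def by (intro continuous_intros)
  qed
  moreover have "connected S" "a \<in> S" "b \<in> S"
    by (simp_all add: S_def)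
  moreover have "g a = c"
    using X by (simp add: g_def v_def ev)
  ultimately have "g b \<noteq> - c"
    using c continuous_abs_const_no_sign_change[of S g N c a b] by blast
  then show ?thesis
    by (simp add: g_def v_def ev)
qed

lemma on_different_branches_commute:
  "on_different_branches \<F> X Y \<longleftrightarrow> on_different_branches \<F> Y X"
  unfolding on_different_branches_def by (metis Un_commute dist_commute)

lemma family_vertices_cases:
  assumes "k > 0" "r > 0" "X \<in> family_vertices (steiner_soddy_family P k Q r)"
  obtains \<theta> where "chain_power P Q r \<theta> \<noteq> 0" "X = chain_vertex P k Q r \<theta>"
proof -
  have "\<exists>\<theta>. chain_centre P k Q r \<theta> X"
    using assms(3) by (auto simp: family_vertices_def steiner_soddy_family_def)
  then show ?thesis
    using that chain_centre_iff[of k r P Q] assms(1,2) by auto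
qed

lemma chain_vertex_in_family_vertices:
  assumes "k > 0" "r > 0" "chain_power P Q r \<theta> \<noteq> 0" "chain_power P Q r (\<theta> + 2 * pi / 3) \<noteq> 0"
    "chain_power P Q r (\<theta> + 4 * pi / 3) \<noteq> 0"
  shows "chain_vertex P k Q r \<theta> \<in> family_vertices (steiner_soddy_family P k Q r)"
proof -
  have "(chain_vertex P k Q r \<theta>, chain_vertex P k Q r (\<theta> + 2 * pi / 3),
      chain_vertex P k Q r (\<theta> + 4 * pi / 3)) \<in> steiner_soddy_family P k Q r"
    using assms chain_centre_iff[of k r P Q] by (auto simp: steiner_soddy_family_def)
  then show ?thesis
    unfolding family_vertices_def by blast
qed

text \<open>
  The conic of the family is an ellipse or a parabola unless some circle of the porism contains \<open>P\<close>
  in its interior; in that case it is a hyperbola, and the sign of the power tells the branch.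
  The condition \<open>pos\<close> holds for any two circles of one chain, because disjoint open discs cannot
  both contain \<open>P\<close>.
\<close>
lemma on_different_branches_iff:
  assumes k: "k > 0" and r: "r > 0" and w0: "point_power P Q (r / sqrt 3) \<noteq> 0"
    and nz: "chain_power P Q r \<theta> \<noteq> 0" "chain_power P Q r \<eta> \<noteq> 0"
    and pos: "chain_power P Q r \<theta> > 0 \<or> chain_power P Q r \<eta> > 0"
  shows "on_different_branches (steiner_soddy_family P k Q r)
      (chain_vertex P k Q r \<theta>) (chain_vertex P k Q r \<eta>) \<longleftrightarrow>
    chain_power P Q r \<theta> * chain_power P Q r \<eta> < 0"
proof -
  let ?\<F> = "steiner_soddy_family P k Q r" and ?w = "chain_power P Q r" and ?v = "chain_vertex P k Q r"
  have same: "\<not> on_different_branches ?\<F> (?v \<theta>) (?v \<eta>)" if "?w \<theta> > 0" "?w \<eta> > 0"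
  proof
    assume "on_different_branches ?\<F> (?v \<theta>) (?v \<eta>)"
    then obtain F G c where c: "0 < c"
      and sub: "family_vertices ?\<F> \<subseteq> hyperbola_branch F G c \<union> hyperbola_branch G F c"
      and X: "?v \<theta> \<in> hyperbola_branch F G c" and Y: "?v \<eta> \<in> hyperbola_branch G F c"
      unfolding on_different_branches_def by blast
    have "\<bar>dist (?v t) G - dist (?v t) F\<bar> = c"
      if "?w t \<noteq> 0" "?w (t + 2 * pi / 3) \<noteq> 0" "?w (t + 4 * pi / 3) \<noteq> 0" for t
      using subsetD[OF sub chain_vertex_in_family_vertices[OF k r that]] c
      by (auto simp: hyperbola_branch_def)
    from same_sign_same_branch[OF r c this that] X Y show False
      by (simp add: hyperbola_branch_def)
  qed
  have diff: "on_different_branches ?\<F> (?v \<alpha>) (?v \<beta>)" if ab: "?w \<alpha> > 0" "?w \<beta> < 0" for \<alpha> \<beta>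
  proof -
    obtain F G c where c: "0 < c" "c < dist F G"
      and FG: "\<And>t. ?w t \<noteq> 0 \<Longrightarrow> dist (?v t) G - dist (?v t) F = sgn (?w t) * c"
      by (rule soddy_centres_separate_vertices[OF k r w0 ab(2)]) (rule that)
    have "family_vertices ?\<F> \<subseteq> hyperbola_branch F G c \<union> hyperbola_branch G F c"
    proof
      fix X assume "X \<in> family_vertices ?\<F>"
      then obtain t where t: "?w t \<noteq> 0" "X = ?v t"
        by (rule family_vertices_cases[OF k r])
      then show "X \<in> hyperbola_branch F G c \<union> hyperbola_branch G F c"
        using FG[of t] by (auto simp: hyperbola_branch_def sgn_if split: if_splits)
    qed
    moreover have "?v \<alpha> \<in> hyperbola_branch F G c" "?v \<beta> \<in> hyperbola_branch G F c"
      using FG[of \<alpha>] FG[of \<beta>] ab by (simp_all add: hyperbola_branch_def)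
    ultimately show ?thesis
      unfolding on_different_branches_def using c by blast
  qed
  show ?thesis
  proof (cases "?w \<theta> > 0 \<and> ?w \<eta> > 0")
    case True
    then show ?thesis
      using same by (simp add: mult_less_0_iff)
  next
    case False
    then have "?w \<theta> > 0 \<and> ?w \<eta> < 0 \<or> ?w \<eta> > 0 \<and> ?w \<theta> < 0"
      using nz pos by linarith
    then show ?thesis
      using diff[of \<theta> \<eta>] diff[of \<eta> \<theta>] on_different_branches_commute[of ?\<F> "?v \<theta>" "?v \<eta>"]
      by (auto simp: mult_less_0_iff)
  qed
qed


section \<open>Conservation over the porism\<close>

text \<open>
  The quotient \<open>x\<close> of the radius of the circle of contact points by the signed radius
  \<open>k\<^sup>2 r / w\<close> is \<open>w / (sqrt 3 \<bar>w0\<bar>)\<close>. The absolute value makes the sum of the three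
  quotients positive also when \<open>P\<close> is inside the incircle of the equilateral triangle.
\<close>
lemma steiner_soddy_triangle:
  fixes P Q :: complex and k r :: real
  defines "w0 \<equiv> point_power P Q (r / sqrt 3)"
  assumes k: "k > 0" and r: "r > 0" and w0: "w0 \<noteq> 0"
    and ABC: "(A, B, C) \<in> steiner_soddy_family P k Q r"
  obtains x y z where
    "tangent_circles A B C (inverse_centre P k Q (r / sqrt 3)) (k\<^sup>2 * r / (sqrt 3 * \<bar>w0\<bar>)) x y z"
    "x + y + z = sqrt 3 * ((dist P Q)\<^sup>2 + r\<^sup>2 / 3) / \<bar>w0\<bar>"
    "half_angle_tan (steiner_soddy_family P k Q r) A B C = x"
    "half_angle_tan (steiner_soddy_family P k Q r) B C A = y"
    "half_angle_tan (steiner_soddy_family P k Q r) C A B = z"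
proof -
  let ?\<F> = "steiner_soddy_family P k Q r" and ?w = "chain_power P Q r" and ?v = "chain_vertex P k Q r"
  let ?I = "inverse_centre P k Q (r / sqrt 3)" and ?\<iota> = "k\<^sup>2 * r / (sqrt 3 * \<bar>w0\<bar>)"
  define \<kappa> where "\<kappa> = sqrt 3 * \<bar>w0\<bar>"
  have \<kappa>: "\<kappa> > 0"
    using w0 by (simp add: \<kappa>_def)
  define \<tau> where "\<tau> \<theta> = ?w \<theta> / \<kappa>" for \<theta>
  obtain \<theta> where "chain_centre P k Q r \<theta> A" "chain_centre P k Q r (\<theta> + 2 * pi / 3) B"
    "chain_centre P k Q r (\<theta> + 4 * pi / 3) C"
    using ABC by (auto simp: steiner_soddy_family_def)
  define \<theta>B \<theta>C where "\<theta>B = \<theta> + 2 * pi / 3" and "\<theta>C = \<theta> + 4 * pi / 3"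
  have wA: "?w \<theta> \<noteq> 0" and A: "A = ?v \<theta>" and wB: "?w \<theta>B \<noteq> 0" and B: "B = ?v \<theta>B"
    and wC: "?w \<theta>C \<noteq> 0" and C: "C = ?v \<theta>C"
    using \<open>chain_centre P k Q r \<theta> A\<close> \<open>chain_centre P k Q r (\<theta> + 2 * pi / 3) B\<close>
      \<open>chain_centre P k Q r (\<theta> + 4 * pi / 3) C\<close> k r
    by (simp_all add: chain_centre_iff \<theta>B_def \<theta>C_def)
  have rad: "inverse_radius P k (equilateral_vertex Q r t) r = ?\<iota> / \<tau> t" for t
    using \<kappa> by (simp add: inverse_radius_def \<tau>_def flip: \<kappa>_def)
  have tangent: "(dist (?v s) (?v t))\<^sup>2 = (?\<iota> / \<tau> s + ?\<iota> / \<tau> t)\<^sup>2"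
    if "?w s \<noteq> 0" "?w t \<noteq> 0" "cos (s - t) = - 1 / 2" for s t
  proof -
    have "(dist (equilateral_vertex Q r s) (equilateral_vertex Q r t))\<^sup>2 = (r + r)\<^sup>2"
      unfolding dist_equilateral_vertices that(3) by (simp add: power2_eq_square)
    from dist_inverse_centres_tangent[OF that(1,2) this] show ?thesis
      by (simp only: rad)
  qed
  have orthogonal: "(dist ?I (?v t))\<^sup>2 = ?\<iota>\<^sup>2 + (?\<iota> / \<tau> t)\<^sup>2" if "?w t \<noteq> 0" for t
  proof -
    have "(dist Q (equilateral_vertex Q r t))\<^sup>2 - (r / sqrt 3)\<^sup>2 - r\<^sup>2 = 0"
      unfolding dist_equilateral_vertex_centre by (simp add: power_divide)
    moreover have "(inverse_radius P k Q (r / sqrt 3))\<^sup>2 = ?\<iota>\<^sup>2"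
      unfolding inverse_radius_def w0_def[symmetric] by (simp add: power_divide power_mult_distrib)
    ultimately show ?thesis
      using dist_inverse_centres[of P Q "r / sqrt 3" "equilateral_vertex Q r t" r k] that w0
      by (simp add: rad w0_def)
  qed
  have "cos (2 * pi / 3) = - 1 / 2" "cos (4 * pi / 3) = - 1 / 2"
    using cos_120_shift[of 0] by simp_all
  moreover have "\<theta> - \<theta>B = - (2 * pi / 3)" "\<theta>B - \<theta>C = - (2 * pi / 3)" "\<theta>C - \<theta> = 4 * pi / 3"
    by (simp_all add: \<theta>B_def \<theta>C_def)
  ultimately have angles: "cos (\<theta> - \<theta>B) = - 1 / 2" "cos (\<theta>B - \<theta>C) = - 1 / 2" "cos (\<theta>C - \<theta>) = - 1 / 2"
    by (simp_all only: cos_minus)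
  have sums: "?w \<theta> + ?w \<theta>B + ?w \<theta>C = 3 * ((dist P Q)\<^sup>2 + r\<^sup>2 / 3)"
    "?w \<theta> * ?w \<theta>B + ?w \<theta>B * ?w \<theta>C + ?w \<theta>C * ?w \<theta> = 3 * w0\<^sup>2"
    unfolding \<theta>B_def \<theta>C_def w0_def by (rule chain_power_sums)+
  have "\<tau> \<theta> + \<tau> \<theta>B + \<tau> \<theta>C = (?w \<theta> + ?w \<theta>B + ?w \<theta>C) / \<kappa>"
    by (simp add: \<tau>_def add_divide_distrib)
  also have "\<dots> = sqrt 3 * ((dist P Q)\<^sup>2 + r\<^sup>2 / 3) / \<bar>w0\<bar>"
  proof -
    have "3 * m / (sqrt 3 * a) = sqrt 3 * m / a" for m a :: real
    proof -
      have "3 * m / (sqrt 3 * a) = (3 / sqrt 3) * m / a" by simp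
      also have "3 / sqrt 3 = sqrt 3" by (rule real_div_sqrt) simp
      finally show ?thesis .
    qed
    then show ?thesis
      unfolding sums \<kappa>_def by blast
  qed
  finally have sum: "\<tau> \<theta> + \<tau> \<theta>B + \<tau> \<theta>C = sqrt 3 * ((dist P Q)\<^sup>2 + r\<^sup>2 / 3) / \<bar>w0\<bar>" .
  have "\<tau> \<theta> * \<tau> \<theta>B + \<tau> \<theta>B * \<tau> \<theta>C + \<tau> \<theta>C * \<tau> \<theta>
      = (?w \<theta> * ?w \<theta>B + ?w \<theta>B * ?w \<theta>C + ?w \<theta>C * ?w \<theta>) / \<kappa>\<^sup>2"
    by (simp add: \<tau>_def add_divide_distrib power2_eq_square)
  also have "\<dots> = 1"
    using w0 unfolding sums by (simp add: \<kappa>_def power_mult_distrib)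
  finally have prods: "\<tau> \<theta> * \<tau> \<theta>B + \<tau> \<theta>B * \<tau> \<theta>C + \<tau> \<theta>C * \<tau> \<theta> = 1" .
  have T: "tangent_circles A B C ?I ?\<iota> (\<tau> \<theta>) (\<tau> \<theta>B) (\<tau> \<theta>C)"
  proof
    show "?\<iota> > 0"
      using k r w0 by simp
    show "\<tau> \<theta> \<noteq> 0" "\<tau> \<theta>B \<noteq> 0" "\<tau> \<theta>C \<noteq> 0"
      using wA wB wC \<kappa> by (simp_all only: \<tau>_def divide_eq_0_iff) simp_all
    show "\<tau> \<theta> + \<tau> \<theta>B + \<tau> \<theta>C > 0"
      unfolding sum using r w0 by (intro divide_pos_pos mult_pos_pos add_nonneg_pos) auto
    show "\<tau> \<theta> * \<tau> \<theta>B + \<tau> \<theta>B * \<tau> \<theta>C + \<tau> \<theta>C * \<tau> \<theta> = 1"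
      by (rule prods)
    show "(dist A B)\<^sup>2 = (?\<iota> / \<tau> \<theta> + ?\<iota> / \<tau> \<theta>B)\<^sup>2"
      unfolding A B by (rule tangent[OF wA wB angles(1)])
    show "(dist B C)\<^sup>2 = (?\<iota> / \<tau> \<theta>B + ?\<iota> / \<tau> \<theta>C)\<^sup>2"
      unfolding B C by (rule tangent[OF wB wC angles(2)])
    show "(dist C A)\<^sup>2 = (?\<iota> / \<tau> \<theta>C + ?\<iota> / \<tau> \<theta>)\<^sup>2"
      unfolding C A by (rule tangent[OF wC wA angles(3)])
    show "(dist ?I A)\<^sup>2 = ?\<iota>\<^sup>2 + (?\<iota> / \<tau> \<theta>)\<^sup>2"
      unfolding A by (rule orthogonal[OF wA])
    show "(dist ?I B)\<^sup>2 = ?\<iota>\<^sup>2 + (?\<iota> / \<tau> \<theta>B)\<^sup>2"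
      unfolding B by (rule orthogonal[OF wB])
    show "(dist ?I C)\<^sup>2 = ?\<iota>\<^sup>2 + (?\<iota> / \<tau> \<theta>C)\<^sup>2"
      unfolding C by (rule orthogonal[OF wC])
  qed
  interpret A: tangent_circles A B C ?I ?\<iota> "\<tau> \<theta>" "\<tau> \<theta>B" "\<tau> \<theta>C" by (rule T)
  interpret B: tangent_circles B C A ?I ?\<iota> "\<tau> \<theta>B" "\<tau> \<theta>C" "\<tau> \<theta>" by (rule A.rotate)
  interpret C: tangent_circles C A B ?I ?\<iota> "\<tau> \<theta>C" "\<tau> \<theta>" "\<tau> \<theta>B" by (rule B.rotate)
  have branch: "on_different_branches ?\<F> (?v s) (?v t) \<longleftrightarrow> \<tau> s * \<tau> t < 0"
    if "?w s \<noteq> 0" "?w t \<noteq> 0" "\<tau> s + \<tau> t > 0" for s t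
  proof -
    have "?w s + ?w t = \<kappa> * (\<tau> s + \<tau> t)"
      using \<kappa> by (simp add: \<tau>_def distrib_left)
    then have "?w s + ?w t > 0"
      using that(3) \<kappa> by simp
    then have "?w s > 0 \<or> ?w t > 0" by linarith
    then have "on_different_branches ?\<F> (?v s) (?v t) \<longleftrightarrow> ?w s * ?w t < 0"
      by (rule on_different_branches_iff[OF k r w0[unfolded w0_def] that(1,2)])
    also have "\<dots> \<longleftrightarrow> \<tau> s * \<tau> t < 0"
      using \<kappa> by (simp add: \<tau>_def divide_less_0_iff)
    finally show ?thesis .
  qed
  note AB = branch[OF wA wB A.sum_pair_pos(1), folded A B]
    and BC = branch[OF wB wC A.sum_pair_pos(2), folded B C]
    and CA = branch[OF wC wA A.sum_pair_pos(3), folded C A]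
  show thesis
  proof (rule that[OF T sum])
    show "half_angle_tan ?\<F> A B C = \<tau> \<theta>"
      using AB BC CA by (intro A.half_angle_tan_A) (simp_all add: on_different_branches_commute[of _ A C] mult.commute)
    show "half_angle_tan ?\<F> B C A = \<tau> \<theta>B"
      using AB BC CA by (intro B.half_angle_tan_A) (simp_all add: on_different_branches_commute[of _ B A] mult.commute)
    show "half_angle_tan ?\<F> C A B = \<tau> \<theta>C"
      using AB BC CA by (intro C.half_angle_tan_A) (simp_all add: on_different_branches_commute[of _ C B] mult.commute)
  qed
qed

theorem proposition4:
  fixes P Q I :: complex and k r \<iota> :: real
  assumes "k > 0" and "r > 0"
    and "inversion P k ` sphere Q (r / sqrt 3) = sphere I \<iota>"
    and "\<F> = steiner_soddy_family P k Q r"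
  shows "\<exists>s\<^sub>1 s\<^sub>2. \<forall>(A, B, C)\<in>\<F>. \<forall>A' B' C'. pedal_triangle I A B C A' B' C' \<longrightarrow>
      half_angle_tan \<F> A B C + half_angle_tan \<F> B C A + half_angle_tan \<F> C A B = s\<^sub>1 \<and>
      cot (internal_angle A' B' C') + cot (internal_angle B' C' A')
        + cot (internal_angle C' A' B') = s\<^sub>1 \<and>
      (half_angle_tan \<F> A B C)\<^sup>2 + (half_angle_tan \<F> B C A)\<^sup>2 + (half_angle_tan \<F> C A B)\<^sup>2 = s\<^sub>2 \<and>
      (cot (internal_angle A' B' C'))\<^sup>2 + (cot (internal_angle B' C' A'))\<^sup>2
        + (cot (internal_angle C' A' B'))\<^sup>2 = s\<^sub>2"
proof -
  have w0: "point_power P Q (r / sqrt 3) \<noteq> 0" and I: "I = inverse_centre P k Q (r / sqrt 3)"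
    using inversion_image_eq_sphere[of k "r / sqrt 3" P Q I \<iota>] assms(1-3) by simp_all
  define s where "s = sqrt 3 * ((dist P Q)\<^sup>2 + r\<^sup>2 / 3) / \<bar>point_power P Q (r / sqrt 3)\<bar>"
  show ?thesis
  proof (rule exI[of _ s], rule exI[of _ "s\<^sup>2 - 2"], clarify)
    fix A B C A' B' C'
    assume "(A, B, C) \<in> \<F>" and pedal: "pedal_triangle I A B C A' B' C'"
    then obtain x y z where T: "tangent_circles A B C I
        (k\<^sup>2 * r / (sqrt 3 * \<bar>point_power P Q (r / sqrt 3)\<bar>)) x y z"
      and sum: "x + y + z = s"
      and tan: "half_angle_tan \<F> A B C = x" "half_angle_tan \<F> B C A = y" "half_angle_tan \<F> C A B = z"
      using steiner_soddy_triangle[OF assms(1,2) w0] unfolding assms(4) I s_def by metis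
    interpret A: tangent_circles A B C I "k\<^sup>2 * r / (sqrt 3 * \<bar>point_power P Q (r / sqrt 3)\<bar>)" x y z
      by (rule T)
    interpret B: tangent_circles B C A I "k\<^sup>2 * r / (sqrt 3 * \<bar>point_power P Q (r / sqrt 3)\<bar>)" y z x
      by (rule A.rotate)
    interpret C: tangent_circles C A B I "k\<^sup>2 * r / (sqrt 3 * \<bar>point_power P Q (r / sqrt 3)\<bar>)" z x y
      by (rule B.rotate)
    have "cot (internal_angle A' B' C') = x" "cot (internal_angle B' C' A') = y"
      "cot (internal_angle C' A' B') = z"
      using pedal A.cot_pedal_angle_A B.cot_pedal_angle_A C.cot_pedal_angle_A
      by (simp_all add: pedal_triangle_def)
    then show "half_angle_tan \<F> A B C + half_angle_tan \<F> B C A + half_angle_tan \<F> C A B = s \<and>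
      cot (internal_angle A' B' C') + cot (internal_angle B' C' A')
        + cot (internal_angle C' A' B') = s \<and>
      (half_angle_tan \<F> A B C)\<^sup>2 + (half_angle_tan \<F> B C A)\<^sup>2 + (half_angle_tan \<F> C A B)\<^sup>2 = s\<^sup>2 - 2 \<and>
      (cot (internal_angle A' B' C'))\<^sup>2 + (cot (internal_angle B' C' A'))\<^sup>2
        + (cot (internal_angle C' A' B'))\<^sup>2 = s\<^sup>2 - 2"
      using sum A.sum_squares by (simp add: tan)
  qed
qed

end
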